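(* (i) Let $W$ be an $n$-gon in $\mathbb{R}^2$ (not necessarily regular) and suppose that there is a largest circle that can be inscribed inside $W$ and that this circle is tangent to each edge of $W$. Let $p$ be the center and $r_0>0$ the radius of this circle. For $r>0$ let $W_r := \{p+\tfrac{r}{r_0}(\vec{x}-p) : \vec{x}\in W\}$ be the rescaled copy of $W$ whose largest inscribed circle has radius $r$ (so $W_{r_0}=W$), let $A(r)$ be the area of the region enclosed by $W_r$, and let $L(r)$ be the length of $W_r$ as a curve. Then $A$ is differentiable and $\frac{dA}{dr}(r)=L(r)$ for all $r>0$. (ii) Let $\Omega$ be a surface in $\mathbb{R}^3$ that is topologically equivalent (homeomorphic) to a sphere. Suppose that $\Omega$ is made up of finitely many planar facets, each having piecewise smooth boundary, and suppose that there is a largest sphere that can be inscribed inside $\Omega$ and that this sphere is tangent to each facet of $\Omega$. Let $p$ be the center and $r_0>0$ the radius of this sphere. For $r>0$ let $\Omega_r := \{p+\tfrac{r}{r_0}(\vec{x}-p) : \vec{x}\in \Omega\}$ be the rescaled copy of $\Omega$ whose largest inscribed sphere has radius $r$ (so $\Omega_{r_0}=\Omega$), let $V(r)$ be the volume of the region bounded by $\Omega_r$, and let $\sigma(r)$ be the surface area of $\Omega_r$. Then $V$ is differentiable and $\frac{dV}{dr}(r)=\sigma(r)$ for all $r>0$.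
   Context: An $n$-gon is understood as a simple closed polygonal curve in $\mathbb{R}^2$ with $n$ vertices; its edges are the line segments that join consecutive vertices. For a surface in $\mathbb{R}^3$ made up of planar regions, these planar regions are called its facets. A circle (respectively sphere) is inscribed inside $W$ (respectively $\Omega$) if it is contained in the closed bounded region enclosed by $W$ (respectively $\Omega$); "largest" means of largest radius. The circle is tangent to an edge if it meets that edge (the segment itself) at a point and the line containing the edge is tangent to the circle at that point; similarly, the sphere is tangent to a facet if it meets that facet (the planar region itself) at a point and the plane containing the facet is tangent to the sphere at that point. *)

theory Defs
  imports "HOL-Analysis.Analysis"
begin

fun polygonal_path :: "'a::real_normed_vector list \<Rightarrow> real \<Rightarrow> 'a" where
  "polygonal_path [] = linepath 0 0"
| "polygonal_path [a] = linepath a a"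
| "polygonal_path [a, b] = linepath a b"
| "polygonal_path (a # b # c # vs) = linepath a b +++ polygonal_path (b # c # vs)"

definition polygon_curve :: "'a::real_normed_vector list \<Rightarrow> real \<Rightarrow> 'a" where
  "polygon_curve vs = polygonal_path (vs @ [hd vs])"

text \<open>Simplicity of the curve forces consecutive vertices to be distinct.
  An angle of 180 degrees at a vertex is permitted.\<close>

definition ngon :: "nat \<Rightarrow> (real^2) list \<Rightarrow> bool" where
  "ngon n vs \<longleftrightarrow> n \<ge> 3 \<and> length vs = n \<and> simple_path (polygon_curve vs)"

definition polygon_edges :: "'a::real_normed_vector list \<Rightarrow> 'a set set" where
  "polygon_edges vs =
     {closed_segment (vs ! i) (vs ! ((i + 1) mod length vs)) | i. i < length vs}"

text \<open>The length of a curve is the supremum of the lengths of its inscribed polygonal lines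
  (meaningful for rectifiable curves only, since the supremum is taken in the reals).\<close>

definition curve_length :: "(real \<Rightarrow> 'a::metric_space) \<Rightarrow> real" where
  "curve_length g =
     (SUP ts \<in> {ts. ts \<noteq> [] \<and> sorted ts \<and> set ts \<subseteq> {0..1}}.
        \<Sum>i<length ts - 1. dist (g (ts ! i)) (g (ts ! Suc i)))"

text \<open>\<^const>\<open>inside\<close> is the union of the bounded components of the complement.\<close>

definition enclosed_region :: "'a::real_normed_vector set \<Rightarrow> 'a set" where
  "enclosed_region S = S \<union> inside S"

definition largest_inscribed_sphere :: "'a::real_normed_vector set \<Rightarrow> 'a \<Rightarrow> real \<Rightarrow> bool" where
  "largest_inscribed_sphere S p r \<longleftrightarrow>
     r > 0 \<and> sphere p r \<subseteq> enclosed_region S \<and>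
     (\<forall>q s. s > 0 \<and> sphere q s \<subseteq> enclosed_region S \<longrightarrow> s \<le> r)"

text \<open>\<open>E\<close> is an edge in the plane or a facet in space, so its affine hull is the line or plane
  containing it; this is required to be the tangent line or plane of the sphere at a point
  of \<open>E\<close> itself.\<close>

definition sphere_tangent_to :: "'a::euclidean_space \<Rightarrow> real \<Rightarrow> 'a set \<Rightarrow> bool" where
  "sphere_tangent_to p r E \<longleftrightarrow>
     (\<exists>x \<in> E \<inter> sphere p r. affine hull E = {y. (y - x) \<bullet> (x - p) = 0})"

definition dilation :: "'a::real_vector \<Rightarrow> real \<Rightarrow> 'a \<Rightarrow> 'a" where
  "dilation p c x = p + c *\<^sub>R (x - p)"

text \<open>A facet is a closed planar region: the closure of a connected, relatively open, nonempty
  subset of a plane. Its boundary need not be connected. Relative interior and relative frontier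
  are taken in the plane \<open>affine hull F\<close>.\<close>

definition planar_facet :: "(real^3) set \<Rightarrow> bool" where
  "planar_facet F \<longleftrightarrow>
     aff_dim F = 2 \<and> bounded F \<and> connected (rel_interior F) \<and> F = closure (rel_interior F)"

definition piecewise_smooth_boundary :: "(real^3) set \<Rightarrow> bool" where
  "piecewise_smooth_boundary F \<longleftrightarrow>
     (\<exists>gs. finite gs \<and> (\<forall>g\<in>gs. valid_path g) \<and> rel_frontier F = (\<Union>g\<in>gs. path_image g))"

definition facet_decomposition :: "(real^3) set \<Rightarrow> (real^3) set set \<Rightarrow> bool" where
  "facet_decomposition \<Omega> \<F> \<longleftrightarrow>
     finite \<F> \<and> \<Omega> = \<Union>\<F> \<and> (\<forall>F\<in>\<F>. planar_facet F) \<and>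
     pairwise (\<lambda>F G. rel_interior F \<inter> rel_interior G = {}) \<F>"

text \<open>The area of a subset of a plane in space is its two-dimensional Lebesgue measure in isometric
  coordinates on that plane; it does not depend on the choice of coordinates.\<close>

definition planar_area :: "(real^3) set \<Rightarrow> real" where
  "planar_area F =
     measure lebesgue
       ((SOME \<phi> :: real^2 \<Rightarrow> real^3.
           (\<forall>x y. dist (\<phi> x) (\<phi> y) = dist x y) \<and> F \<subseteq> range \<phi>) -` F)"

definition surface_area :: "(real^3) set set \<Rightarrow> real" where
  "surface_area \<F> = (\<Sum>F\<in>\<F>. planar_area F)"

end

theory Submission
  imports Defs
begin

text \<open>Since everything scales, it suffices to show that the measure of the enclosed region is
  \<open>r0 / d\<close> times the total measure of the facets. All facet planes have distance \<open>r0\<close> from \<open>p\<close>, so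
  the cone from \<open>p\<close> over a facet \<open>F\<close> has measure \<open>r0 / d\<close> times that of \<open>F\<close>; hence the enclosed region
  should, up to a null set, be the disjoint union of these cones, i.e. almost every ray from \<open>p\<close>
  should leave it exactly once. By invariance of domain the surface is locally a piece of a
  hyperplane at every point in the relative interior of a facet and at every point of tangency, and by the
  Jordan-Brouwer theorem one side of that piece is then inside and the other outside. At a point of
  tangency the sphere shows that the side facing \<open>p\<close> is inside; since the relative interior of a facet
  is connected, the same holds along the whole facet. So a ray that avoids all relative
  boundaries of facets can only cross the surface outwards, and never a second time.\<close>

section \<open>Cones over planar sets\<close>

text \<open>No convexity is assumed, so the fact that the region is star-shaped from
  \<open>p\<close> up to a null set has to be proved. The point of tangency of a facet may lie on
  its relative boundary, next to other facets, where flatness is not obvious. It holds because a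
  facet plane touches the sphere only once: every facet through a point of tangency is itself
  tangent there, so all of them share one plane. Since only the sphere, and not a ball, is given as
  part of the enclosed region, it is points of the sphere near the point of tangency that reveal
  which side is inside. The rays that have to be discarded fill cones over relative boundaries.
  These are null because the boundaries consist of two endpoints in the plane and of finitely many
  piecewise C1 curves in space. \<open>planar_area\<close> picks its chart by \<open>SOME\<close>,
  so the charts of a facet and of its dilate are unrelated; areas are therefore compared through the
  volumes of cones.\<close>

definition isometric_map :: "('b::metric_space \<Rightarrow> 'a::metric_space) \<Rightarrow> bool" where
  "isometric_map \<phi> \<longleftrightarrow> (\<forall>x y. dist (\<phi> x) (\<phi> y) = dist x y)"

definition solid_cone :: "'a::real_vector \<Rightarrow> 'a set \<Rightarrow> 'a set" where
  "solid_cone p F = (\<Union>t\<in>{0..1}. dilation p t ` F)"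

section \<open>Linear isometries and Lebesgue measure\<close>

lemma linear_isometric_map_diff:
  fixes \<phi> :: "'b::euclidean_space \<Rightarrow> 'a::euclidean_space"
  assumes "isometric_map \<phi>"
  shows "linear (\<lambda>x. \<phi> x - \<phi> 0)" "norm (\<phi> x - \<phi> 0) = norm x"
proof -
  define L where "L = (\<lambda>x. \<phi> x - \<phi> 0)"
  have nd: "norm (L x - L y) = norm (x - y)" for x y
    using assms by (simp add: L_def isometric_map_def dist_norm)
  have nL: "norm (L x) = norm x" for x
    using nd[of x 0] by (simp add: L_def)
  then show "norm (\<phi> x - \<phi> 0) = norm x"
    by (simp add: L_def)
  \<comment> \<open>Polarization turns preserved distances into preserved inner products. Linearity
    follows because the squared norm of each defect expands into inner products that cancel.\<close>
  have inn: "L x \<bullet> L y = x \<bullet> y" for x y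
    using nd[of x y] nL[of x] nL[of y] by (simp add: dot_norm_neg)
  have "linear L"
  proof (rule linearI)
    fix x y
    have "(norm (L (x + y) - (L x + L y)))\<^sup>2 = 0"
      unfolding power2_norm_eq_inner
      by (simp add: inner_diff_left inner_diff_right inner_add_left inner_add_right inn inner_commute)
    then show "L (x + y) = L x + L y" by simp
  next
    fix c x
    have "(norm (L (c *\<^sub>R x) - c *\<^sub>R L x))\<^sup>2 = 0"
      unfolding power2_norm_eq_inner
      by (simp add: inner_diff_left inner_diff_right inn inner_commute)
    then show "L (c *\<^sub>R x) = c *\<^sub>R L x" by simp
  qed
  then show "linear (\<lambda>x. \<phi> x - \<phi> 0)" by (simp add: L_def)
qed

text \<open>The cone is computed in the product type \<open>real \<times> 'b\<close> but lives in
  \<open>real^'n\<close>; matching the two bases moves the measure between the types. Boxes pull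
  back to boxes with the same side lengths, and the box formula characterizes
  \<open>lborel\<close>.\<close>

lemma lborel_distr_basis_bijection:
  fixes f :: "'a::euclidean_space \<Rightarrow> 'b::euclidean_space"
  assumes f: "bij_betw f Basis Basis"
  shows "distr lborel borel (\<lambda>x. \<Sum>b\<in>Basis. (x \<bullet> b) *\<^sub>R f b) = lborel"
proof (rule lborel_eqI[symmetric])
  define k where "k = (\<lambda>x. \<Sum>b\<in>Basis. (x \<bullet> b) *\<^sub>R f b)"
  define k' where "k' = (\<lambda>y. \<Sum>b\<in>Basis. (y \<bullet> f b) *\<^sub>R b)"
  have fB: "f b \<in> Basis" if "b \<in> Basis" for b
    using f that by (auto dest: bij_betwE)
  have finj: "f b = f c \<longleftrightarrow> b = c" if "b \<in> Basis" "c \<in> Basis" for b c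
    using f that by (auto simp: bij_betw_def inj_on_def)
  have fim: "f ` Basis = Basis"
    using f by (simp add: bij_betw_def)
  have ki: "k x \<bullet> f c = x \<bullet> c" if "c \<in> Basis" for x c
  proof -
    have "k x \<bullet> f c = (\<Sum>b\<in>Basis. if b = c then x \<bullet> b else 0)"
      unfolding k_def inner_sum_left
      by (rule sum.cong) (auto simp: inner_Basis fB finj that)
    then show ?thesis using that by simp
  qed
  have k'i: "k' y \<bullet> c = y \<bullet> f c" if "c \<in> Basis" for y c
    using that by (simp add: k'_def)
  fix l u :: 'b
  assume lu: "\<And>b. b \<in> Basis \<Longrightarrow> l \<bullet> b \<le> u \<bullet> b"
  have pre: "k -` box l u = box (k' l) (k' u)"
  proof -
    have "x \<in> k -` box l u \<longleftrightarrow> x \<in> box (k' l) (k' u)" for x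
    proof -
      have "x \<in> k -` box l u \<longleftrightarrow> (\<forall>b\<in>f ` Basis. l \<bullet> b < k x \<bullet> b \<and> k x \<bullet> b < u \<bullet> b)"
        by (simp add: mem_box fim)
      also have "\<dots> \<longleftrightarrow> x \<in> box (k' l) (k' u)"
        by (simp add: mem_box ki k'i)
      finally show ?thesis .
    qed
    then show ?thesis by blast
  qed
  have [measurable]: "k \<in> borel_measurable lborel"
    by (simp add: k_def)
  have "emeasure (distr lborel borel k) (box l u) = emeasure lborel (k -` box l u)"
    by (subst emeasure_distr) auto
  also have "\<dots> = (\<Prod>b\<in>Basis. (k' u - k' l) \<bullet> b)"
    unfolding pre by (rule emeasure_lborel_box) (simp add: k'i lu fB)
  also have "(\<Prod>b\<in>Basis. (k' u - k' l) \<bullet> b) = (\<Prod>b\<in>Basis. (u - l) \<bullet> f b)"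
    by (rule prod.cong) (auto simp: inner_diff_left k'i)
  also have "\<dots> = (\<Prod>b\<in>Basis. (u - l) \<bullet> b)"
    using prod.reindex_bij_betw[OF f, of "\<lambda>b. (u - l) \<bullet> b"] by simp
  finally show "emeasure (distr lborel borel (\<lambda>x. \<Sum>b\<in>Basis. (x \<bullet> b) *\<^sub>R f b)) (box l u)
      = (\<Prod>b\<in>Basis. (u - l) \<bullet> b)" by (simp add: k_def)
qed simp

text \<open>\<open>T\<close> is split as \<open>T \<circ> g\<close> after \<open>k\<close>, with
  \<open>g\<close> inverse to \<open>k\<close>: the basis matching \<open>k\<close> preserves
  measure although it changes the type, and \<open>T \<circ> g\<close> is an orthogonal
  transformation of \<open>real^'n\<close>.\<close>

lemma measure_linear_isometry_image:
  fixes T :: "'a::euclidean_space \<Rightarrow> real^'n::{finite,wellorder}"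
  assumes dim: "DIM('a) = CARD('n)" and T: "linear T" "\<And>x. norm (T x) = norm x"
    and S: "compact S"
  shows "measure lebesgue (T ` S) = measure lebesgue S"
proof -
  obtain f :: "'a \<Rightarrow> (real, 'n) vec" where f: "bij_betw f Basis Basis"
    using dim finite_same_card_bij[of "Basis::'a set" "Basis::(real, 'n) vec set"] by auto
  define k where "k = (\<lambda>x. \<Sum>b\<in>Basis. (x \<bullet> b) *\<^sub>R f b)"
  have fB: "f b \<in> Basis" if "b \<in> Basis" for b
    using f that by (auto dest: bij_betwE)
  have finj: "f b = f c \<longleftrightarrow> b = c" if "b \<in> Basis" "c \<in> Basis" for b c
    using f that by (auto simp: bij_betw_def inj_on_def)
  have lk: "linear k"
    unfolding k_def by (intro linear_compose_sum) (auto intro!: linearI simp: inner_add_left algebra_simps)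
  have ki: "k x \<bullet> f c = x \<bullet> c" if "c \<in> Basis" for x c
  proof -
    have "k x \<bullet> f c = (\<Sum>b\<in>Basis. if b = c then x \<bullet> b else 0)"
      unfolding k_def inner_sum_left
      by (rule sum.cong) (auto simp: inner_Basis fB finj that)
    then show ?thesis using that by simp
  qed
  have nk: "norm (k x) = norm x" for x
  proof -
    have "k x \<bullet> k x = (\<Sum>c\<in>Basis. (x \<bullet> c) * (k x \<bullet> f c))"
      by (subst (2) k_def) (simp add: inner_sum_right)
    also have "\<dots> = (\<Sum>c\<in>Basis. (x \<bullet> c) * (x \<bullet> c))"
      by (rule sum.cong) (auto simp: ki)
    also have "\<dots> = x \<bullet> x" by (simp add: euclidean_inner[symmetric])
    finally show ?thesis by (simp add: norm_eq_sqrt_inner)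
  qed
  have ik: "inj k"
    by (metis lk nk linear_injective_0 norm_eq_zero)
  have sk: "surj k"
  proof -
    have "dim (range k) = DIM('a)"
      using dim_image_eq[of k UNIV] lk ik by simp
    then have "dim (range k) = DIM((real, 'n) vec)"
      using dim by simp
    then have "span (range k) = UNIV"
      by (rule dim_eq_full[THEN iffD1])
    then show ?thesis
      by (metis lk linear_subspace_image span_eq_iff subspace_UNIV)
  qed
  have comp: "compact (k ` S)"
    using S lk by (intro compact_continuous_image linear_continuous_on) (simp_all add: linear_linear)
  have [measurable]: "k \<in> borel_measurable lborel"
    by (simp add: k_def)
  have "emeasure lborel (k ` S) = emeasure (distr lborel borel k) (k ` S)"
    using lborel_distr_basis_bijection[OF f] by (simp add: k_def)
  also have "\<dots> = emeasure lborel (k -` k ` S)"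
    using comp by (subst emeasure_distr) (auto intro: borel_compact)
  also have "k -` k ` S = S" using ik by (rule inj_vimage_image_eq)
  finally have 1: "measure lebesgue (k ` S) = measure lebesgue S"
    using S comp by (simp add: measure_def borel_compact)
  obtain g where g: "linear g" "g \<circ> k = id"
    using linear_injective_left_inverse[OF lk ik] by blast
  have kg: "k (g y) = y" for y
    using sk g(2) by (metis comp_apply id_apply surj_def)
  have O: "orthogonal_transformation (T \<circ> g)"
    unfolding orthogonal_transformation
  proof (intro conjI allI)
    show "linear (T \<circ> g)" by (rule linear_compose[OF g(1) T(1)])
    show "norm ((T \<circ> g) v) = norm v" for v
      using T(2)[of "g v"] nk[of "g v"] kg[of v] by simp
  qed
  have "T ` S = (T \<circ> g) ` k ` S"
    using g(2) by (auto simp: image_comp fun_eq_iff)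
  then show ?thesis
    using measure_orthogonal_image[OF O, of "k ` S"] comp 1 by (simp add: lmeasurable_compact)
qed

section \<open>Volumes of cones by slicing\<close>

lemma continuous_on_dilation: "continuous_on S (\<lambda>(t, y::'a::real_normed_vector). dilation p t y)"
  unfolding dilation_def case_prod_unfold by (intro continuous_intros)

lemma solid_cone_altdef: "solid_cone p F = (\<lambda>(t, y). dilation p t y) ` ({0..1} \<times> F)"
  by (auto simp: solid_cone_def)

lemma compact_solid_cone:
  fixes F :: "'a::real_normed_vector set"
  assumes "compact F"
  shows "compact (solid_cone p F)"
  unfolding solid_cone_altdef
  by (intro compact_continuous_image continuous_on_dilation compact_Times assms) auto

text \<open>With \<open>m\<close> the dimension of the base, \<open>(s / h) ^ m\<close> is the
  factor by which the slice at height \<open>s\<close> shrinks. This integral is the source of the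
  1/2 and the 1/3 in the cone formulas.\<close>

lemma nn_integral_power_ratio:
  assumes "h > (0::real)"
  shows "(\<integral>\<^sup>+s\<in>{0..h}. ennreal ((s / h) ^ m) \<partial>lborel) = ennreal (h / (m + 1))"
proof -
  have "(\<integral>\<^sup>+s. ennreal ((s / h) ^ m) * indicator {0..h} s \<partial>lborel)
      = ennreal (h / (m + 1) * (h / h) ^ (m + 1) - h / (m + 1) * (0 / h) ^ (m + 1))"
  proof (rule nn_integral_FTC_Icc)
    fix x
    have "((\<lambda>x. x / h) has_real_derivative 1 / h) (at x)"
      by (rule DERIV_cdivide) (rule DERIV_ident)
    from DERIV_cmult[OF DERIV_power_Suc[OF this, of m], of "h / (m + 1)"]
    show "((\<lambda>x. h / (m + 1) * (x / h) ^ (m + 1)) has_real_derivative (x / h) ^ m) (at x)"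
      using assms by (simp add: add.commute)
  qed (use assms in auto)
  then show ?thesis using assms by simp
qed

lemma isometric_map_linear_part:
  fixes \<phi> :: "'b::euclidean_space \<Rightarrow> 'a::euclidean_space"
  assumes "isometric_map \<phi>"
  shows "\<exists>L. linear L \<and> (\<forall>x. norm (L x) = norm x) \<and> (\<forall>x c. \<phi> x - \<phi> c = L (x - c))"
proof (intro exI conjI allI)
  note L = linear_isometric_map_diff[OF assms]
  show "linear (\<lambda>x. \<phi> x - \<phi> 0)" "norm (\<phi> x - \<phi> 0) = norm x" for x
    by (fact L)+
  show "\<phi> x - \<phi> c = \<phi> (x - c) - \<phi> 0" for x c
    using linear_diff[OF L(1), of x c] by simp
qed

text \<open>Cavalieri's principle in the coordinates (height, base) with the apex at the origin. The
  point \<open>c\<close> is the foot of the perpendicular from the apex, so the slice at height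
  \<open>s\<close> is the base translated by \<open>- c\<close> and scaled by
  \<open>s / h\<close>.\<close>

lemma emeasure_cone_over_base:
  fixes A :: "'b::euclidean_space set"
  assumes h: "h > 0" and A: "compact A"
  shows "emeasure lborel ((\<lambda>(t, u). (t * h, t *\<^sub>R (u - c))) ` ({0..1} \<times> A))
    = ennreal (h / (DIM('b) + 1)) * emeasure lborel A"
proof -
  define D where "D = (\<lambda>(t, u). (t * h, t *\<^sub>R (u - c))) ` ({0..1} \<times> A)"
  have "compact D"
    unfolding D_def
    by (intro compact_continuous_image compact_Times A)
       (auto simp: case_prod_unfold intro!: continuous_intros)
  then have D[measurable]: "D \<in> sets borel"
    by (rule borel_compact)
  have slice: "emeasure lborel (Pair s -` D)
      = emeasure lborel A * (ennreal ((s / h) ^ DIM('b)) * indicator {0..h} s)" for s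
  proof (cases "0 < s \<and> s \<le> h")
    case True
    have "Pair s -` D = (\<lambda>u. (s / h) *\<^sub>R u + (- (s / h) *\<^sub>R c)) ` A" (is "_ = ?B")
      unfolding D_def using True h
      by (auto simp: image_iff scaleR_diff_right field_simps intro!: bexI[of _ "s / h"])
    moreover have "compact ?B"
      by (intro compact_continuous_image continuous_intros A)
    then have "emeasure lborel ?B = emeasure lebesgue ?B"
      by (simp add: borel_compact)
    moreover have "emeasure lborel A = emeasure lebesgue A"
      using A by (simp add: borel_compact)
    ultimately show ?thesis
      using True h emeasure_lebesgue_affine[of "s / h" "- (s / h) *\<^sub>R c" A]
      by (simp add: mult.commute ennreal_power)
  next
    case False
    then consider "s = 0" | "s < 0" | "s > h" by linarith
    then show ?thesis
    proof cases
      \<comment> \<open>The slice at the apex is null, and so is the claimed value: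
        \<open>DIM('b)\<close> is positive, hence \<open>(0 / h) ^ DIM('b)\<close> vanishes.\<close>
      case 1
      have "Pair s -` D \<subseteq> {0}"
        unfolding D_def using 1 h by auto
      then have "emeasure lborel (Pair s -` D) \<le> emeasure lborel {0::'b}"
        by (rule emeasure_mono) simp
      then show ?thesis using 1 h by simp
    next
      case 2
      then have "Pair s -` D = {}"
        unfolding D_def using h by (auto simp: mult_less_0_iff)
      then show ?thesis using 2 by simp
    next
      case 3
      have "Pair s -` D = {}"
        unfolding D_def using 3 h by (auto simp: mult_le_cancel_right1 dest!: leD)
      then show ?thesis using 3 by simp
    qed
  qed
  have "emeasure lborel D = emeasure (lborel \<Otimes>\<^sub>M lborel) D"
    by (simp add: lborel_prod)
  also have "\<dots> = (\<integral>\<^sup>+s. emeasure lborel (Pair s -` D) \<partial>lborel)"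
    by (rule lborel.emeasure_pair_measure_alt) (subst lborel_prod, simp)
  also have "\<dots> = emeasure lborel A * (\<integral>\<^sup>+s\<in>{0..h}. ennreal ((s / h) ^ DIM('b)) \<partial>lborel)"
    unfolding slice by (rule nn_integral_cmult) simp
  also have "\<dots> = ennreal (h / (DIM('b) + 1)) * emeasure lborel A"
    using nn_integral_power_ratio[OF h, of "DIM('b)"] by (simp add: mult.commute)
  finally show ?thesis by (simp add: D_def)
qed

text \<open>\<open>T\<close> sends the height coordinate along the normal \<open>n\<close> and the
  base along the linear part of \<phi>. These directions are orthogonal, so \<open>T\<close> is an
  isometry, and up to translation by \<open>p\<close> it carries the model cone onto
  \<open>solid_cone p F\<close>.\<close>

lemma measure_solid_cone:
  fixes \<phi> :: "'b::euclidean_space \<Rightarrow> real^'n::{finite,wellorder}"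
  assumes dim: "CARD('n) = DIM('b) + 1" and iso: "isometric_map \<phi>"
    and F: "compact F" "F \<subseteq> range \<phi>"
    and n: "norm n = 1" and h: "h > 0" and rng: "range \<phi> = {y. n \<bullet> (y - p) = h}"
  shows "measure lebesgue (solid_cone p F) = h / CARD('n) * measure lebesgue (\<phi> -` F)"
proof -
  obtain L where L: "linear L" "\<And>x. norm (L x) = norm x" "\<And>x c. \<phi> x - \<phi> c = L (x - c)"
    using isometric_map_linear_part[OF iso] by blast
  have nn: "n \<bullet> n = 1"
    using n by (simp add: norm_eq_1)
  then have "p + h *\<^sub>R n \<in> range \<phi>"
    by (simp add: rng)
  then obtain c where c: "\<phi> c = p + h *\<^sub>R n" by auto
  define T where "T = (\<lambda>(s, u). L u + s *\<^sub>R n)"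
  have T: "linear T"
    by (auto simp: T_def case_prod_unfold linear_add[OF L(1)] linear_cmul[OF L(1)] algebra_simps
        intro!: linearI)
  have orth: "n \<bullet> L u = 0" for u
  proof -
    have "n \<bullet> (\<phi> (u + c) - p) = h" "n \<bullet> (\<phi> c - p) = h"
      using rng by blast+
    then have "n \<bullet> (\<phi> (u + c) - \<phi> c) = 0"
      by (simp add: inner_diff_right)
    then show ?thesis by (simp add: L(3))
  qed
  have nT: "norm (T x) = norm x" for x
  proof -
    obtain s u where x: "x = (s, u)" by fastforce
    have "T x \<bullet> T x = L u \<bullet> L u + s * s"
      using orth[of u] nn by (simp add: x T_def inner_add_left inner_add_right inner_commute)
    also have "L u \<bullet> L u = u \<bullet> u"
      using L(2)[of u] by (metis power2_norm_eq_inner)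
    also have "u \<bullet> u + s * s = x \<bullet> x" by (simp add: x)
    finally show ?thesis by (simp add: norm_eq_sqrt_inner)
  qed
  define A where "A = \<phi> -` F"
  have A: "compact A"
  proof -
    have "\<phi> = (\<lambda>x. \<phi> 0 + L x)"
    proof
      show "\<phi> x = \<phi> 0 + L x" for x using L(3)[of x 0] by (simp add: diff_eq_eq add.commute)
    qed
    moreover have "continuous_on UNIV (\<lambda>x. \<phi> 0 + L x)"
      using L(1) by (intro continuous_intros linear_continuous_on) (simp add: linear_linear)
    ultimately have cont: "continuous_on UNIV \<phi>" by metis
    then have "closed A"
      unfolding A_def using F(1) by (simp add: closed_vimage compact_imp_closed)
    moreover have "bounded A"
    proof -
      obtain B where B: "\<And>y. y \<in> F \<Longrightarrow> dist (\<phi> 0) y \<le> B"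
        using compact_imp_bounded[OF F(1)] by (metis bounded_any_center)
      have "dist 0 x \<le> B" if "x \<in> A" for x
        using B[of "\<phi> x"] that iso by (simp add: A_def isometric_map_def)
      then show ?thesis unfolding bounded_any_center[of _ "0::'b"] by blast
    qed
    ultimately show ?thesis by (simp add: compact_eq_bounded_closed)
  qed
  have FA: "F = \<phi> ` A" using F(2) by (auto simp: A_def)
  define D where "D = (\<lambda>(t, u). (t * h, t *\<^sub>R (u - c))) ` ({0..1} \<times> A)"
  have D: "compact D"
    unfolding D_def
    by (intro compact_continuous_image compact_Times A)
       (auto simp: case_prod_unfold intro!: continuous_intros)
  have eq: "dilation p t (\<phi> u) = p + T (t * h, t *\<^sub>R (u - c))" for t u
  proof -
    have "\<phi> u - p = L (u - c) + h *\<^sub>R n"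
      using L(3)[of u c] c by (simp add: algebra_simps)
    then show ?thesis
      by (simp add: dilation_def T_def linear_cmul[OF L(1)] scaleR_add_right)
  qed
  have "solid_cone p F = (+) p ` T ` D"
    by (force simp: solid_cone_altdef FA D_def eq image_iff)
  then have "measure lebesgue (solid_cone p F) = measure lebesgue (T ` D)"
    by (simp add: measure_translation)
  also have "\<dots> = measure lebesgue D"
    by (rule measure_linear_isometry_image[OF _ T nT D]) (simp add: dim)
  also have "\<dots> = measure lborel D"
    using D by (simp add: borel_compact)
  also have "\<dots> = h / CARD('n) * measure lborel A"
    using emeasure_cone_over_base[OF h A, of c] h
    by (simp add: measure_def D_def dim enn2real_mult)
  also have "measure lborel A = measure lebesgue A"
    using A by (simp add: borel_compact)
  finally show ?thesis by (simp add: A_def)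
qed

text \<open>Both sets are affine and have the dimension of their subset \<open>F\<close>, so both
  are its affine hull. Hence every isometric chart that covers \<open>F\<close> parametrizes exactly
  the plane of \<open>F\<close>.\<close>

lemma isometric_range_eq_affine:
  fixes \<phi> :: "'b::euclidean_space \<Rightarrow> 'a::euclidean_space"
  assumes iso: "isometric_map \<phi>" and F: "F \<subseteq> range \<phi>" "aff_dim F = DIM('b)"
    and H: "affine H" "aff_dim H = DIM('b)" "F \<subseteq> H"
  shows "range \<phi> = H"
proof -
  obtain L where L: "linear L" "\<And>x. norm (L x) = norm x" "\<And>x c. \<phi> x - \<phi> c = L (x - c)"
    using isometric_map_linear_part[OF iso] by blast
  have "\<phi> x = \<phi> 0 + L x" for x
    using L(3)[of x 0] by (metis add_diff_cancel_left' add_diff_eq diff_zero)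
  then have rng: "range \<phi> = (+) (\<phi> 0) ` range L"
    unfolding image_image by (intro image_cong refl)
  have "inj L"
    using L(1,2) by (metis norm_eq_zero linear_injective_0)
  then have dim: "dim (range L) = DIM('b)"
    using dim_image_eq[OF L(1), of UNIV] by simp
  have sub: "subspace (range L)"
    by (rule linear_subspace_image[OF L(1) subspace_UNIV])
  have aff: "affine (range \<phi>)"
    unfolding rng using subspace_imp_affine[OF sub] affine_translation by blast
  have ad: "aff_dim (range \<phi>) = DIM('b)"
    unfolding rng aff_dim_translation_eq using sub dim by (simp add: aff_dim_subspace)
  have ne: "affine hull F \<noteq> {}"
    using F(2) by auto
  have "affine hull F = range \<phi>"
    using F ad aff ne by (intro affine_dim_equal) (auto simp: hull_minimal)
  moreover have "affine hull F = H"
    using F H ne by (intro affine_dim_equal) (auto simp: hull_minimal)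
  ultimately show ?thesis by simp
qed

lemma isometric_parametrization_exists:
  fixes F :: "'a::euclidean_space set"
  assumes "aff_dim F = DIM('b::euclidean_space)"
  obtains \<phi> :: "'b::euclidean_space \<Rightarrow> 'a" where "isometric_map \<phi>" "F \<subseteq> range \<phi>"
proof -
  obtain a where a: "a \<in> F" using assms by fastforce
  define S where "S = (+) (- a) ` (affine hull F)"
  have S: "subspace S"
    unfolding S_def using a affine_diffs_subspace[of "affine hull F" a] by (simp add: hull_inc)
  have "aff_dim S = DIM('b)"
    unfolding S_def using assms by (simp only: aff_dim_translation_eq aff_dim_affine_hull)
  then have "dim S = DIM('b)" using S by (simp add: aff_dim_subspace)
  then have "dim (UNIV :: 'b set) = dim S" by simp
  then obtain f :: "'b \<Rightarrow> 'a" and g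
    where f: "linear f" "f ` UNIV = S" "\<And>x. norm (f x) = norm x"
    using isometries_subspaces[OF subspace_UNIV S] by (metis UNIV_I)
  show thesis
  proof
    show "isometric_map (\<lambda>x. a + f x)"
      by (simp add: isometric_map_def dist_norm linear_diff[OF f(1), symmetric] f(3))
    show "F \<subseteq> range (\<lambda>x. a + f x)"
    proof
      fix y assume "y \<in> F"
      then have "y - a \<in> S" by (auto simp: S_def hull_inc)
      then obtain x where "y - a = f x" using f(2) by blast
      then have "y = a + f x" by (simp add: algebra_simps)
      then show "y \<in> range (\<lambda>x. a + f x)" by blast
    qed
  qed
qed

lemma affine_offset_hyperplane: "affine {y. n \<bullet> (y - p) = h}"
  using affine_hyperplane[of n "h + n \<bullet> p"] by (simp add: inner_diff_right diff_eq_eq)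

lemma aff_dim_offset_hyperplane:
  fixes n :: "'a::euclidean_space"
  assumes "n \<noteq> 0"
  shows "aff_dim {y. n \<bullet> (y - p) = h} = DIM('a) - 1"
  using aff_dim_hyperplane[OF assms, of "h + n \<bullet> p"] by (simp add: inner_diff_right diff_eq_eq)

lemma measure_cone_over_planar_set:
  fixes \<phi> :: "'b::euclidean_space \<Rightarrow> real^'n::{finite,wellorder}"
  assumes dim: "CARD('n) = DIM('b) + 1" and iso: "isometric_map \<phi>" "F \<subseteq> range \<phi>"
    and F: "compact F" "aff_dim F = DIM('b)" "F \<subseteq> {y. n \<bullet> (y - p) = h}"
    and n: "norm n = 1" and h: "h > 0"
  shows "measure lebesgue (solid_cone p F) = h / CARD('n) * measure lebesgue (\<phi> -` F)"
proof (rule measure_solid_cone[OF dim iso(1) F(1) iso(2) n h])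
  have "n \<noteq> 0" using n by auto
  then show "range \<phi> = {y. n \<bullet> (y - p) = h}"
    using iso F dim
    by (intro isometric_range_eq_affine affine_offset_hyperplane) (simp_all add: aff_dim_offset_hyperplane)
qed

text \<open>\<open>SOME\<close> leaves the chart in \<open>planar_area\<close> unspecified; a chart
  exists, and the cone formula holds for every chart that covers \<open>F\<close>.\<close>

lemma measure_cone_planar_area:
  fixes F :: "(real^3) set"
  assumes F: "compact F" "aff_dim F = 2" "F \<subseteq> {y. n \<bullet> (y - p) = h}"
    and n: "norm n = 1" and h: "h > 0"
  shows "measure lebesgue (solid_cone p F) = h / 3 * planar_area F"
proof -
  define \<phi> :: "real^2 \<Rightarrow> real^3"
    where "\<phi> = (SOME \<phi>. (\<forall>x y. dist (\<phi> x) (\<phi> y) = dist x y) \<and> F \<subseteq> range \<phi>)"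
  obtain \<psi> :: "real^2 \<Rightarrow> real^3" where "isometric_map \<psi>" "F \<subseteq> range \<psi>"
    using isometric_parametrization_exists[where 'b = "real^2", of F] F(2) by auto
  then have "\<exists>\<phi> :: real^2 \<Rightarrow> real^3. (\<forall>x y. dist (\<phi> x) (\<phi> y) = dist x y) \<and> F \<subseteq> range \<phi>"
    by (auto simp: isometric_map_def)
  from someI_ex[OF this] have "isometric_map \<phi>" "F \<subseteq> range \<phi>"
    by (auto simp: isometric_map_def \<phi>_def)
  then have "measure lebesgue (solid_cone p F) = h / CARD(3) * measure lebesgue (\<phi> -` F)"
    using F n h by (intro measure_cone_over_planar_set) auto
  then show ?thesis by (simp add: planar_area_def \<phi>_def)
qed

lemma measure_cone_segment:
  fixes a b :: "real^2"
  assumes ab: "a \<noteq> b" "closed_segment a b \<subseteq> {y. n \<bullet> (y - p) = h}"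
    and n: "norm n = 1" and h: "h > 0"
  shows "measure lebesgue (solid_cone p (closed_segment a b)) = h / 2 * dist a b"
proof -
  define l where "l = dist a b"
  have l: "l > 0" using ab by (simp add: l_def)
  \<comment> \<open>Arclength chart of the line through \<open>a\<close> and \<open>b\<close>, with
    \<open>real\<close> itself as the one-dimensional base space; the segment is the image of
    \<open>{0..l}\<close>.\<close>
  define \<phi> where "\<phi> = (\<lambda>t. a + (t / l) *\<^sub>R (b - a))"
  have iso: "isometric_map \<phi>"
  proof -
    have "dist (\<phi> x) (\<phi> y) = dist x y" for x y
    proof -
      have "\<phi> x - \<phi> y = ((x - y) / l) *\<^sub>R (b - a)"
        by (simp add: \<phi>_def diff_divide_distrib scaleR_diff_left)
      then have "dist (\<phi> x) (\<phi> y) = \<bar>x - y\<bar> / l * norm (b - a)"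
        using l by (simp add: dist_norm)
      also have "norm (b - a) = l" by (simp add: l_def dist_norm norm_minus_commute)
      finally show ?thesis using l by (simp add: dist_real_def)
    qed
    then show ?thesis by (simp add: isometric_map_def)
  qed
  have seg: "\<phi> x \<in> closed_segment a b \<longleftrightarrow> x \<in> {0..l}" for x
  proof
    assume "\<phi> x \<in> closed_segment a b"
    then obtain u where u: "0 \<le> u" "u \<le> 1" "\<phi> x = (1 - u) *\<^sub>R a + u *\<^sub>R b"
      by (auto simp: closed_segment_def)
    then have "\<phi> x = \<phi> (u * l)"
      using l by (simp add: \<phi>_def algebra_simps)
    then have "x = u * l" using iso by (metis dist_eq_0_iff isometric_map_def)
    then show "x \<in> {0..l}" using u l by (simp add: mult_left_le_one_le)
  next
    assume "x \<in> {0..l}"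
    then show "\<phi> x \<in> closed_segment a b"
      using l by (auto simp: closed_segment_def \<phi>_def algebra_simps intro!: exI[of _ "x / l"])
  qed
  have rng: "closed_segment a b \<subseteq> range \<phi>"
  proof
    fix y assume "y \<in> closed_segment a b"
    then obtain u where "y = (1 - u) *\<^sub>R a + u *\<^sub>R b"
      by (auto simp: closed_segment_def)
    then have "y = \<phi> (u * l)"
      using l by (simp add: \<phi>_def algebra_simps)
    then show "y \<in> range \<phi>" by simp
  qed
  have ad: "aff_dim (closed_segment a b) = 1"
    using ab(1) by (simp add: segment_convex_hull aff_dim_convex_hull)
  have "measure lebesgue (solid_cone p (closed_segment a b))
      = h / CARD(2) * measure lebesgue (\<phi> -` closed_segment a b)"
    using ad ab n h rng by (intro measure_cone_over_planar_set iso) auto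
  also have "\<phi> -` closed_segment a b = {0..l}" using seg by auto
  finally show ?thesis using l by (simp add: l_def)
qed

section \<open>Effect of dilations on measures and areas\<close>

lemma dilation_eq: "dilation p c x = c *\<^sub>R x + (p - c *\<^sub>R p)"
  by (simp add: dilation_def algebra_simps)

lemma measure_dilation_image:
  fixes S :: "'a::euclidean_space set"
  shows "measure lebesgue (dilation p c ` S) = \<bar>c\<bar> ^ DIM('a) * measure lebesgue S"
  using measure_lebesgue_affine[of c "p - c *\<^sub>R p" S] by (simp add: dilation_eq[abs_def])

lemma solid_cone_dilation: "solid_cone p (dilation p c ` F) = dilation p c ` solid_cone p F"
  by (simp add: solid_cone_def image_UN image_image dilation_def mult.commute)

text \<open>The cone over the dilated facet is the dilated cone. Its volume grows by
  \<open>c ^ 3\<close> and its height by \<open>c\<close>, which leaves \<open>c\<^sup>2\<close> for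
  the area of the base.\<close>

lemma planar_area_dilation:
  fixes F :: "(real^3) set"
  assumes F: "compact F" "aff_dim F = 2" "F \<subseteq> {y. n \<bullet> (y - p) = h}"
    and n: "norm n = 1" and h: "h > 0" and c: "c > 0"
  shows "planar_area (dilation p c ` F) = c\<^sup>2 * planar_area F"
proof -
  have eq: "dilation p c ` F = (+) (p - c *\<^sub>R p) ` (*\<^sub>R) c ` F"
    unfolding image_image by (rule image_cong) (auto simp: dilation_eq)
  have "aff_dim (dilation p c ` F) = 2"
    unfolding eq aff_dim_translation_eq using c F(2)
    by (subst aff_dim_injective_linear_image) (auto simp: inj_on_def)
  moreover have "compact (dilation p c ` F)"
    unfolding dilation_def by (intro compact_continuous_image continuous_intros F(1))
  moreover have "dilation p c ` F \<subseteq> {y. n \<bullet> (y - p) = c * h}"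
    using F(3) by (auto simp: dilation_def)
  ultimately have "measure lebesgue (solid_cone p (dilation p c ` F)) = c * h / 3 * planar_area (dilation p c ` F)"
    using n h c by (intro measure_cone_planar_area) auto
  moreover have "measure lebesgue (solid_cone p (dilation p c ` F)) = c ^ 3 * (h / 3 * planar_area F)"
    unfolding solid_cone_dilation measure_dilation_image
    using measure_cone_planar_area[OF F n h] c by simp
  ultimately show ?thesis
    using h c by (simp add: power3_eq_cube power2_eq_square)
qed

section \<open>Surfaces with all facets tangent to an inscribed sphere\<close>

lemma connected_subset_inside_or_outside:
  assumes "connected C" "C \<inter> S = {}"
  shows "C \<subseteq> inside S \<or> C \<subseteq> outside S"
proof (cases "C \<inter> inside S = {}")
  case True
  then show ?thesis using assms(2) by (auto simp: outside_inside)
next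
  case False
  then obtain x where x: "x \<in> C" "x \<in> inside S" by auto
  have "y \<in> inside S" if "y \<in> C" for y
  proof -
    have "connected_component (- S) x y"
      unfolding connected_component_def using assms x that by blast
    then show ?thesis using x inside_same_component by blast
  qed
  then show ?thesis by blast
qed

lemma dilation_dilation: "dilation p s (dilation p t x) = dilation p (s * t) x"
  by (simp add: dilation_def)

lemma dilation_1 [simp]: "dilation p 1 x = x"
  by (simp add: dilation_def)

text \<open>The equality case of Cauchy-Schwarz: a plane at distance \<open>r\<close> from the
  center meets the sphere only once.\<close>

lemma sphere_tangent_point_unique:
  fixes n :: "'a::real_inner"
  assumes "norm n = 1" "x \<in> sphere p r" "n \<bullet> (x - p) = r"
  shows "x = p + r *\<^sub>R n"
proof -
  have nn: "n \<bullet> n = 1" using assms(1) by (simp add: norm_eq_1)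
  have "(x - p) \<bullet> (x - p) = r\<^sup>2"
    using assms(2) by (metis dist_norm mem_sphere norm_minus_commute power2_norm_eq_inner)
  then have "(norm (x - p - r *\<^sub>R n))\<^sup>2 = 0"
    unfolding power2_norm_eq_inner using assms(3) nn
    by (simp add: inner_diff_left inner_diff_right inner_commute power2_eq_square algebra_simps)
  then have "x - p - r *\<^sub>R n = 0" by simp
  then show ?thesis by (simp add: algebra_simps)
qed

lemma connected_offset_halfspaces:
  fixes n :: "'a::euclidean_space"
  shows "connected (ball y e \<inter> {z. n \<bullet> (z - p) < h})" "connected (ball y e \<inter> {z. n \<bullet> (z - p) > h})"
proof -
  have eq: "{z. n \<bullet> (z - p) < h} = {z. n \<bullet> z < h + n \<bullet> p}" "{z. n \<bullet> (z - p) > h} = {z. n \<bullet> z > h + n \<bullet> p}"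
    by (auto simp: inner_diff_right)
  show "connected (ball y e \<inter> {z. n \<bullet> (z - p) < h})" "connected (ball y e \<inter> {z. n \<bullet> (z - p) > h})"
    unfolding eq
    by (intro convex_connected convex_Int convex_ball convex_halfspace_lt convex_halfspace_gt)+
qed

text \<open>One setting for polygons and polyhedra: facets of codimension 1 on a topological sphere.
  The regularity of facet boundaries enters in the last assumption, the form in which endpoints of
  edges and piecewise C1 curves can be treated alike.\<close>

locale tangential_surface =
  fixes \<Omega> :: "'a::euclidean_space set" and \<F> :: "'a set set" and p :: 'a and r :: real
  assumes dim_ge_2: "2 \<le> DIM('a)"
    and sphere_like: "\<Omega> homeomorphic sphere (0::'a) 1"
    and finite_facets: "finite \<F>"
    and surface_eq: "\<Omega> = \<Union>\<F>"
    and facet_dim: "F \<in> \<F> \<Longrightarrow> aff_dim F = DIM('a) - 1"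
    and facet_connected: "F \<in> \<F> \<Longrightarrow> connected (rel_interior F)"
    and facet_closure: "F \<in> \<F> \<Longrightarrow> F = closure (rel_interior F)"
    and facets_disjoint: "pairwise (\<lambda>F G. rel_interior F \<inter> rel_interior G = {}) \<F>"
    and radius_pos: "r > 0"
    and inscribed: "sphere p r \<subseteq> enclosed_region \<Omega>"
    and tangent: "F \<in> \<F> \<Longrightarrow> sphere_tangent_to p r F"
    and negligible_rel_frontier_cone: "F \<in> \<F> \<Longrightarrow> negligible (\<Union>t. dilation p t ` rel_frontier F)"
begin

section \<open>Inside and outside of the surface\<close>

lemma compact_surface: "compact \<Omega>"
  using homeomorphic_compactness[OF sphere_like] by simp

lemma closed_surface: "closed \<Omega>"
  by (rule compact_imp_closed[OF compact_surface])

lemma closed_facet: "F \<in> \<F> \<Longrightarrow> closed F"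
  using facet_closure by (metis closed_closure)

lemma compact_facet: "F \<in> \<F> \<Longrightarrow> compact F"
  using compact_surface closed_facet surface_eq
  by (metis Sup_upper compact_Int_closed inf.absorb_iff2)

text \<open>By Jordan-Brouwer every component of the complement of a topological sphere has the
  whole surface as its frontier, and in dimension at least 2 the outside of a bounded set is such a
  component.\<close>

lemma surface_subset_closure_outside: "\<Omega> \<subseteq> closure (outside \<Omega>)"
proof -
  have "outside \<Omega> \<in> components (- \<Omega>)"
    unfolding outside_in_components
    using compact_imp_bounded[OF compact_surface] dim_ge_2 connected_outside outside_bounded_nonempty by blast
  from Jordan_Brouwer_frontier[OF sphere_like this dim_ge_2] show ?thesis
    by (auto simp: frontier_def)
qed

text \<open>A single component contained in the inside suffices, since its frontier is already all
  of \<Omega>. One exists, because otherwise the complement would be the connected outside, against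
  the separation theorem.\<close>

lemma surface_subset_closure_inside: "\<Omega> \<subseteq> closure (inside \<Omega>)"
proof -
  have "inside \<Omega> \<noteq> {}"
  proof
    assume "inside \<Omega> = {}"
    then have "outside \<Omega> = - \<Omega>"
      using inside_Un_outside[of \<Omega>] by simp
    moreover have "connected (outside \<Omega>)"
      using compact_imp_bounded[OF compact_surface] dim_ge_2 by (rule connected_outside)
    ultimately show False
      using Jordan_Brouwer_separation[OF sphere_like] by simp
  qed
  then obtain z where z: "z \<in> inside \<Omega>" by auto
  define C where "C = connected_component_set (- \<Omega>) z"
  have "C \<in> components (- \<Omega>)"
    unfolding components_def C_def using z inside_no_overlap[of \<Omega>] by blast
  then have "frontier C = \<Omega>"
    by (rule Jordan_Brouwer_frontier[OF sphere_like _ dim_ge_2])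
  moreover have "C \<subseteq> inside \<Omega>"
    using z inside_same_component by (auto simp: C_def)
  ultimately show ?thesis
    using closure_mono[of C "inside \<Omega>"] unfolding frontier_def by blast
qed

definition nrm :: "'a set \<Rightarrow> 'a" where
  "nrm F = (SOME n. norm n = 1 \<and> p + r *\<^sub>R n \<in> F \<and> affine hull F = {y. n \<bullet> (y - p) = r})"

text \<open>Passing from the point of tangency to the unit normal turns the tangent plane into the
  level set of height \<open>r\<close> above \<open>p\<close>. Such heights are linear along rays
  from \<open>p\<close>, which is what the crossing argument needs.\<close>

lemma nrm:
  assumes "F \<in> \<F>"
  shows "norm (nrm F) = 1" "p + r *\<^sub>R nrm F \<in> F" "affine hull F = {y. nrm F \<bullet> (y - p) = r}"
proof -
  obtain x where x: "x \<in> F" "dist p x = r" "affine hull F = {y. (y - x) \<bullet> (x - p) = 0}"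
    using tangent[OF assms] by (auto simp: sphere_tangent_to_def)
  define n where "n = (x - p) /\<^sub>R r"
  have xp: "x - p = r *\<^sub>R n" using radius_pos by (simp add: n_def)
  have nn: "norm n = 1"
    using x(2) radius_pos by (simp add: n_def dist_norm norm_minus_commute)
  have "(y - x) \<bullet> (x - p) = 0 \<longleftrightarrow> n \<bullet> (y - p) = r" for y
  proof -
    have "(y - x) \<bullet> (x - p) = ((y - p) - (x - p)) \<bullet> (x - p)" by simp
    also have "\<dots> = r * (n \<bullet> (y - p) - r)"
      unfolding xp using nn by (simp add: norm_eq_1 inner_diff_left inner_commute algebra_simps)
    finally show ?thesis using radius_pos by simp
  qed
  moreover have "p + r *\<^sub>R n = x" using xp by (metis add_diff_cancel_left' add_diff_eq)
  ultimately have "\<exists>n. norm n = 1 \<and> p + r *\<^sub>R n \<in> F \<and> affine hull F = {y. n \<bullet> (y - p) = r}"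
    using x nn by (intro exI[of _ n]) auto
  from someI_ex[OF this] show "norm (nrm F) = 1" "p + r *\<^sub>R nrm F \<in> F"
    "affine hull F = {y. nrm F \<bullet> (y - p) = r}"
    by (auto simp: nrm_def)
qed

lemma facet_plane: "F \<in> \<F> \<Longrightarrow> y \<in> F \<Longrightarrow> nrm F \<bullet> (y - p) = r"
  using nrm(3)[of F] hull_inc[of y F affine] by auto

section \<open>Local flatness by invariance of domain\<close>

lemma surface_homeomorphism:
  obtains h k where "homeomorphism \<Omega> (sphere (0::'a) 1) h k"
    "\<And>x. x \<in> \<Omega> \<Longrightarrow> k (h x) = x" "\<And>x. x \<in> \<Omega> \<Longrightarrow> h x \<in> sphere 0 1"
    "\<And>x. x \<in> sphere 0 1 \<Longrightarrow> h (k x) = x" "\<And>x. x \<in> sphere 0 1 \<Longrightarrow> k x \<in> \<Omega>"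
    "continuous_on \<Omega> h" "continuous_on (sphere 0 1) k"
proof -
  obtain h k where "homeomorphism \<Omega> (sphere (0::'a) 1) h k"
    using sphere_like by (auto simp: homeomorphic_def)
  then show thesis
    by (intro that[of h k]) (auto simp: homeomorphism_def simp del: mem_sphere_0)
qed

text \<open>All facets through the tangent point lie in one hyperplane and the finitely many others
  keep a distance from it, so a small piece of \<Omega> is contained in that hyperplane. Invariance
  of domain shows that the piece also fills the hyperplane near the point.\<close>

lemma surface_flat_at_tangent_point:
  assumes F: "F \<in> \<F>"
  obtains e where "e > 0"
    "\<Omega> \<inter> ball (p + r *\<^sub>R nrm F) e = affine hull F \<inter> ball (p + r *\<^sub>R nrm F) e"
proof -
  define x where "x = p + r *\<^sub>R nrm F"
  have x: "x \<in> F" "x \<in> \<Omega>" using nrm(2)[OF F] F by (auto simp: x_def surface_eq)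
  have xs: "x \<in> sphere p r" using nrm(1)[OF F] radius_pos by (simp add: x_def dist_norm)
  \<comment> \<open>The plane of \<open>G\<close> meets the sphere only once, so \<open>x\<close> is
    also the tangent point of \<open>G\<close>; the two normals and hence the two planes
    agree.\<close>
  have same: "G \<subseteq> affine hull F" if G: "G \<in> \<F>" "x \<in> G" for G
  proof -
    have "x = p + r *\<^sub>R nrm G"
      using sphere_tangent_point_unique[OF nrm(1)[OF G(1)] xs] facet_plane[OF G] by simp
    then have "nrm G = nrm F" using radius_pos by (simp add: x_def)
    then show ?thesis using nrm(3)[OF F] nrm(3)[OF G(1)] hull_subset[of G affine] by simp
  qed
  define K where "K = \<Union>{G \<in> \<F>. x \<notin> G}"
  have "closed K"
    unfolding K_def using finite_facets closed_facet by (intro closed_Union) auto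
  moreover have "x \<notin> K" by (auto simp: K_def)
  ultimately obtain e where e: "e > 0" "ball x e \<inter> K = {}"
    by (metis Compl_iff disjoint_eq_subset_Compl open_Compl open_contains_ball)
  define U where "U = \<Omega> \<inter> ball x e"
  have UH: "U \<subseteq> affine hull F"
    using e(2) same by (auto simp: U_def surface_eq K_def)
  obtain h k where hk: "homeomorphism \<Omega> (sphere (0::'a) 1) h k"
    and hk_simps: "\<And>x. x \<in> \<Omega> \<Longrightarrow> k (h x) = x" "\<And>x. x \<in> sphere 0 1 \<Longrightarrow> h (k x) = x"
      "continuous_on (sphere 0 1) k"
    by (rule surface_homeomorphism) metis
  have U: "openin (top_of_set \<Omega>) U"
    by (simp add: U_def openin_open_Int)
  have hU: "openin (top_of_set (sphere 0 1)) (h ` U)"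
    by (rule homeomorphism_imp_open_map[OF hk U])
  have kh: "k ` h ` U = U"
    unfolding image_image using hk_simps(1) by (simp add: U_def)
  have hUs: "h ` U \<subseteq> sphere 0 1"
    by (rule openin_imp_subset[OF hU])
  have kon: "continuous_on (h ` U) k"
    by (rule continuous_on_subset[OF hk_simps(3) hUs])
  have kinj: "inj_on k (h ` U)"
    by (rule inj_on_inverseI[of _ h]) (use hUs hk_simps(2) in blast)
  \<comment> \<open>\<open>k\<close> is continuous and injective from a relatively open part of the
    sphere into a hyperplane, which has the dimension of the sphere; hence the image is open
    there.\<close>
  have "openin (top_of_set (affine hull F)) (k ` h ` U)"
    by (rule invariance_of_domain_sphere_affine_set[OF kon kinj _ _ _ _ hU])
       (use kh UH facet_dim[OF F] dim_ge_2 in \<open>auto simp: of_nat_diff\<close>)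
  then obtain d where d: "d > 0" "ball x d \<inter> affine hull F \<subseteq> U"
    unfolding kh using openin_contains_ball x e(1) by (metis IntI U_def centre_in_ball)
  show thesis
  proof (rule that)
    show "min d e > 0" using d(1) e(1) by simp
    show "\<Omega> \<inter> ball (p + r *\<^sub>R nrm F) (min d e) = affine hull F \<inter> ball (p + r *\<^sub>R nrm F) (min d e)"
      unfolding x_def[symmetric] using d(2) UH by (auto simp: U_def)
  qed
qed

text \<open>Here openness passes from the plane of \<open>F\<close> to \<Omega>, which keeps other
  facets from accumulating at the relative interior. Invariance of domain is applied between affine
  sets, so the sphere is punctured and identified with the hyperplane.\<close>

lemma openin_rel_interior_facet:
  assumes F: "F \<in> \<F>"
  shows "openin (top_of_set \<Omega>) (rel_interior F)"
proof (subst openin_subopen, intro ballI)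
  fix y assume y: "y \<in> rel_interior F"
  have sub: "rel_interior F \<subseteq> \<Omega>"
    using rel_interior_subset F by (auto simp: surface_eq)
  obtain h k where hk: "homeomorphism \<Omega> (sphere (0::'a) 1) h k"
    and hk_simps: "\<And>x. x \<in> \<Omega> \<Longrightarrow> k (h x) = x" "\<And>x. x \<in> \<Omega> \<Longrightarrow> h x \<in> sphere 0 1"
      "\<And>x. x \<in> sphere 0 1 \<Longrightarrow> h (k x) = x" "\<And>x. x \<in> sphere 0 1 \<Longrightarrow> k x \<in> \<Omega>"
      "continuous_on \<Omega> h"
    by (rule surface_homeomorphism) metis
  \<comment> \<open>The puncture may be any point of the sphere other than \<open>h y\<close>; the
    antipode is one. Its preimage \<open>k q\<close> is removed from \<open>rel_interior F\<close>
    so that \<open>h\<close> maps \<open>W\<close> into the punctured sphere.\<close>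
  define q where "q = - h y"
  have hy: "h y \<in> sphere 0 1" using y sub hk_simps(2) by blast
  then have q: "q \<in> sphere 0 1" "q \<noteq> h y"
    by (auto simp: q_def neg_eq_iff_add_eq_0 simp flip: scaleR_2)
  define W where "W = rel_interior F - {k q}"
  have W: "openin (top_of_set (affine hull F)) W"
    unfolding W_def by (rule openin_delete[OF openin_rel_interior])
  have yW: "y \<in> W"
    using y q hk_simps(3) by (auto simp: W_def)
  have WO: "W \<subseteq> \<Omega>" using sub by (auto simp: W_def)
  have "(sphere 0 1 - {q}) homeomorphic affine hull F"
    by (rule homeomorphic_punctured_sphere_affine)
       (use q facet_dim[OF F] dim_ge_2 in \<open>auto simp: of_nat_diff\<close>)
  then obtain g g' where g: "homeomorphism (sphere 0 1 - {q}) (affine hull F) g g'"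
    by (auto simp: homeomorphic_def)
  have hW: "h ` W \<subseteq> sphere 0 1 - {q}"
  proof (rule image_subsetI)
    fix x assume x: "x \<in> W"
    then have "x \<in> \<Omega>" "x \<noteq> k q" using WO by (auto simp: W_def)
    then show "h x \<in> sphere 0 1 - {q}" using hk_simps(1,2) by fastforce
  qed
  have injh: "inj_on h W"
    using hk_simps(1) WO by (metis inj_onI subsetD)
  have injg: "inj_on g (sphere 0 1 - {q})"
    using g by (auto simp: homeomorphism_def intro: inj_on_inverseI)
  have gW: "openin (top_of_set (affine hull F)) ((g \<circ> h) ` W)"
  proof (rule invariance_of_domain_affine_sets[OF W])
    show "continuous_on W (g \<circ> h)"
      using continuous_on_subset[OF hk_simps(5) WO] continuous_on_subset[OF homeomorphism_cont1[OF g] hW]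
      by (rule continuous_on_compose)
    show "g \<circ> h \<in> W \<rightarrow> affine hull F"
    proof
      fix x assume "x \<in> W"
      then have "h x \<in> sphere 0 1 - {q}" using hW by blast
      then show "(g \<circ> h) x \<in> affine hull F"
        using homeomorphism_image1[OF g] unfolding o_apply by blast
    qed
    show "inj_on (g \<circ> h) W"
      by (rule comp_inj_on[OF injh inj_on_subset[OF injg hW]])
  qed auto
  have "openin (top_of_set (sphere 0 1 - {q})) (g' ` (g \<circ> h) ` W)"
    by (rule homeomorphism_imp_open_map[OF homeomorphism_symD[OF g] gW])
  moreover have "g' ` (g \<circ> h) ` W = h ` W"
  proof -
    have "g' (g x) = x" if "x \<in> sphere 0 1 - {q}" for x
      using g that unfolding homeomorphism_def by blast
    then have "g' (g (h x)) = h x" if "x \<in> W" for x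
      using hW that by blast
    then show ?thesis by (simp add: image_image)
  qed
  moreover have "openin (top_of_set (sphere 0 1)) (sphere 0 1 - {q})"
    by (intro openin_delete) simp
  ultimately have "openin (top_of_set (sphere 0 1)) (h ` W)"
    by (metis openin_trans)
  then have "openin (top_of_set \<Omega>) (k ` h ` W)"
    by (rule homeomorphism_imp_open_map[OF homeomorphism_symD[OF hk]])
  moreover have "k ` h ` W = W"
    unfolding image_image using hk_simps(1) WO by (simp add: subset_iff)
  ultimately show "\<exists>T. openin (top_of_set \<Omega>) T \<and> y \<in> T \<and> T \<subseteq> rel_interior F"
    using yW by (auto simp: W_def)
qed

lemma surface_flat_at_rel_interior:
  assumes F: "F \<in> \<F>" and y: "y \<in> rel_interior F"
  obtains e where "e > 0" "\<Omega> \<inter> ball y e = affine hull F \<inter> ball y e"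
    "\<Omega> \<inter> ball y e \<subseteq> rel_interior F"
proof -
  obtain d where d: "d > 0" "ball y d \<inter> \<Omega> \<subseteq> rel_interior F"
    using openin_rel_interior_facet[OF F] y by (metis openin_contains_ball)
  obtain d' where d': "d' > 0" "ball y d' \<inter> affine hull F \<subseteq> rel_interior F"
    using openin_rel_interior[of F] y by (metis openin_contains_ball)
  have sub: "rel_interior F \<subseteq> \<Omega>" "rel_interior F \<subseteq> affine hull F"
    using rel_interior_subset[of F] F hull_subset[of F affine] unfolding surface_eq by blast+
  show thesis
  proof (rule that)
    have b: "ball y (min d d') = ball y d \<inter> ball y d'" by auto
    show "min d d' > 0" using d(1) d'(1) by simp
    show "\<Omega> \<inter> ball y (min d d') = affine hull F \<inter> ball y (min d d')"
      "\<Omega> \<inter> ball y (min d d') \<subseteq> rel_interior F"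
      unfolding b using d(2) d'(2) sub by blast+
  qed
qed

text \<open>Since \<open>G\<close> is the closure of its relative interior, a common point would be
  approached by points of \<open>rel_interior G\<close>, whereas near it all of \<Omega> belongs to
  \<open>rel_interior F\<close>.\<close>

lemma rel_interior_facet_disjoint:
  assumes F: "F \<in> \<F>" and G: "G \<in> \<F>" "F \<noteq> G"
  shows "rel_interior F \<inter> G = {}"
proof (rule ccontr)
  assume "rel_interior F \<inter> G \<noteq> {}"
  then obtain y where y: "y \<in> rel_interior F" "y \<in> G" by auto
  obtain e where e: "e > 0" "\<Omega> \<inter> ball y e \<subseteq> rel_interior F"
    using surface_flat_at_rel_interior[OF F y(1)] by metis
  obtain z where z: "z \<in> rel_interior G" "dist y z < e"
    using facet_closure[OF G(1)] y(2) e(1) closure_approachableD by blast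
  have "z \<in> \<Omega>" using z rel_interior_subset G by (auto simp: surface_eq)
  then have "z \<in> rel_interior F" using e z by auto
  then show False using facets_disjoint F G z by (auto simp: pairwise_def)
qed

section \<open>The two sides of a facet\<close>

abbreviation below :: "'a set \<Rightarrow> 'a \<Rightarrow> real \<Rightarrow> 'a set" where
  "below F y e \<equiv> ball y e \<inter> {z. nrm F \<bullet> (z - p) < r}"

abbreviation above :: "'a set \<Rightarrow> 'a \<Rightarrow> real \<Rightarrow> 'a set" where
  "above F y e \<equiv> ball y e \<inter> {z. nrm F \<bullet> (z - p) > r}"

text \<open>Each open half-ball is convex and avoids \<Omega>, so it lies on one side. They cannot
  both lie on the same side, since \<open>y\<close> is a limit of points of the other side and these
  would have to be in one of the half-balls.\<close>

lemma surface_two_sided: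
  assumes F: "F \<in> \<F>" and y: "y \<in> \<Omega>" and e: "e > 0"
    and flat: "\<Omega> \<inter> ball y e = affine hull F \<inter> ball y e"
  shows "below F y e \<subseteq> inside \<Omega> \<and> above F y e \<subseteq> outside \<Omega> \<or>
    below F y e \<subseteq> outside \<Omega> \<and> above F y e \<subseteq> inside \<Omega>"
proof -
  have plane: "nrm F \<bullet> (z - p) = r" if "z \<in> \<Omega>" "z \<in> ball y e" for z
  proof -
    have "z \<in> affine hull F" using flat that by blast
    then show ?thesis by (simp add: nrm(3)[OF F])
  qed
  then have "below F y e \<inter> \<Omega> = {}" "above F y e \<inter> \<Omega> = {}"
    by fastforce+
  then have dich: "below F y e \<subseteq> inside \<Omega> \<or> below F y e \<subseteq> outside \<Omega>"
    "above F y e \<subseteq> inside \<Omega> \<or> above F y e \<subseteq> outside \<Omega>"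
    by (simp_all only: connected_subset_inside_or_outside[OF connected_offset_halfspaces(1)]
        connected_subset_inside_or_outside[OF connected_offset_halfspaces(2)])
  have False if ST: "below F y e \<subseteq> S" "above F y e \<subseteq> S" "S \<inter> T = {}" "T \<inter> \<Omega> = {}"
    "\<Omega> \<subseteq> closure T" for S T
  proof -
    obtain z where z: "z \<in> T" "dist y z < e"
      using ST(5) y e closure_approachableD by blast
    have "z \<notin> affine hull F"
      using flat z ST(4) by auto
    then have "nrm F \<bullet> (z - p) \<noteq> r" by (simp add: nrm(3)[OF F])
    then have "z \<in> below F y e \<union> above F y e"
      using z(2) by (simp add: neq_iff)
    then show False using ST z by blast
  qed
  note one_sided = this
  have disj: "inside \<Omega> \<inter> outside \<Omega> = {}" "outside \<Omega> \<inter> inside \<Omega> = {}"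
    using inside_Int_outside[of \<Omega>] by blast+
  have "\<not> (below F y e \<subseteq> inside \<Omega> \<and> above F y e \<subseteq> inside \<Omega>)"
    using one_sided[OF _ _ disj(1) outside_no_overlap surface_subset_closure_outside] by blast
  moreover have "\<not> (below F y e \<subseteq> outside \<Omega> \<and> above F y e \<subseteq> outside \<Omega>)"
    using one_sided[OF _ _ disj(2) inside_no_overlap surface_subset_closure_inside] by blast
  ultimately show ?thesis using dich by argo
qed

lemma below_nonempty:
  assumes "F \<in> \<F>" "nrm F \<bullet> (y - p) = r" "e > 0"
  shows "below F y e \<noteq> {}"
proof -
  have "nrm F \<bullet> nrm F = 1" using nrm(1)[OF assms(1)] by (simp add: norm_eq_1)
  then have "y - (e / 2) *\<^sub>R nrm F \<in> below F y e"
    using assms nrm(1)[OF assms(1)] by (simp add: dist_norm inner_diff_right)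
  then show ?thesis by blast
qed

lemma below_mono:
  assumes "dist y' y + d \<le> e"
  shows "below F y' d \<subseteq> below F y e"
proof -
  have "ball y' d \<subseteq> ball y e"
    using assms by (simp add: ball_subset_ball_iff)
  then show ?thesis by blast
qed

text \<open>Points of the sphere close to the tangent point lie strictly below the tangent plane,
  hence off the flat surface, and belong to the enclosed region. So they are inside, and they decide
  for the whole half-ball.\<close>

lemma below_tangent_point_inside:
  assumes F: "F \<in> \<F>"
  obtains e where "e > 0" "below F (p + r *\<^sub>R nrm F) e \<subseteq> inside \<Omega>"
proof -
  define x where "x = p + r *\<^sub>R nrm F"
  obtain e where e: "e > 0" "\<Omega> \<inter> ball x e = affine hull F \<inter> ball x e"
    using surface_flat_at_tangent_point[OF F] by (metis x_def)
  have x: "x \<in> \<Omega>" using nrm(2)[OF F] F by (auto simp: x_def surface_eq)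
  have xs: "x \<in> sphere p r" using nrm(1)[OF F] radius_pos by (simp add: x_def dist_norm)
  \<comment> \<open>Nearby points of the sphere exist because it is connected, as the dimension is
    at least 2, and contains the antipodal pair \<open>x\<close>, \<open>x'\<close>.\<close>
  have "x islimpt sphere p r"
  proof (rule connected_imp_perfect[OF _ xs])
    show "connected (sphere p r)" using dim_ge_2 by (rule connected_sphere)
    define x' where "x' = p - r *\<^sub>R nrm F"
    have "x - x' = (2 * r) *\<^sub>R nrm F"
      unfolding mult_2 scaleR_left_distrib by (simp add: x_def x'_def)
    then have "x' \<noteq> x" using nrm(1)[OF F] radius_pos by auto
    moreover have "x' \<in> sphere p r"
      using nrm(1)[OF F] radius_pos by (simp add: x'_def dist_norm)
    ultimately show "sphere p r \<noteq> {z}" for z using xs by (metis singletonD)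
  qed
  then obtain z where z: "z \<in> sphere p r" "z \<noteq> x" "dist z x < e"
    using e(1) by (auto simp: islimpt_approachable)
  have "nrm F \<bullet> (z - p) \<le> norm (nrm F) * norm (z - p)"
    by (rule norm_cauchy_schwarz)
  then have "nrm F \<bullet> (z - p) \<le> r"
    using nrm(1)[OF F] z(1) by (simp add: dist_norm norm_minus_commute)
  moreover have "nrm F \<bullet> (z - p) \<noteq> r"
    using sphere_tangent_point_unique[OF nrm(1)[OF F] z(1)] z(2) by (auto simp: x_def)
  ultimately have zb: "z \<in> below F x e" using z by (simp add: dist_commute)
  have "z \<notin> \<Omega>"
  proof
    assume "z \<in> \<Omega>"
    then have "z \<in> affine hull F" using e(2) zb by blast
    then show False using nrm(3)[OF F] zb by simp
  qed
  then have "z \<in> inside \<Omega>" using inscribed z(1) by (auto simp: enclosed_region_def)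
  then have "z \<notin> outside \<Omega>" using inside_Int_outside[of \<Omega>] by blast
  then have "\<not> below F x e \<subseteq> outside \<Omega>"
    using subsetD[OF _ zb] by metis
  then have "below F x e \<subseteq> inside \<Omega>"
    using surface_two_sided[OF F x e] by argo
  then show thesis using that e(1) by (simp add: x_def)
qed

text \<open>The points whose lower side is inside and those whose lower side is outside form two
  disjoint relatively open sets that cover the connected \<open>rel_interior F\<close>, so one of
  them is empty. The tangent point decides which.\<close>

lemma facet_sides:
  assumes F: "F \<in> \<F>" and y: "y \<in> rel_interior F"
  obtains e where "e > 0" "below F y e \<subseteq> inside \<Omega>" "above F y e \<subseteq> outside \<Omega>"
proof -
  define A where "A S = {y \<in> rel_interior F. \<exists>e>0. below F y e \<subseteq> S}" for S
  have plane: "nrm F \<bullet> (z - p) = r" if "z \<in> rel_interior F" for z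
    using facet_plane[OF F] that rel_interior_subset by blast
  have opn: "openin (top_of_set (rel_interior F)) (A S)" for S
    unfolding openin_contains_ball
  proof (intro conjI ballI)
    fix z assume "z \<in> A S"
    then obtain e where e: "e > 0" "below F z e \<subseteq> S" by (auto simp: A_def)
    have "ball z (e / 2) \<inter> rel_interior F \<subseteq> A S"
    proof
      fix w assume w: "w \<in> ball z (e / 2) \<inter> rel_interior F"
      then have "below F w (e / 2) \<subseteq> below F z e"
        by (intro below_mono) (simp add: dist_commute)
      then show "w \<in> A S" using w e by (auto simp: A_def intro!: exI[of _ "e / 2"])
    qed
    then show "\<exists>e>0. ball z e \<inter> rel_interior F \<subseteq> A S"
      using e(1) by (intro exI[of _ "e / 2"]) auto
  qed (auto simp: A_def)
  have sides: "\<exists>e>0. below F z e \<subseteq> inside \<Omega> \<and> above F z e \<subseteq> outside \<Omega> \<or>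
      below F z e \<subseteq> outside \<Omega> \<and> above F z e \<subseteq> inside \<Omega>" if z: "z \<in> rel_interior F" for z
  proof -
    obtain e where e: "e > 0" "\<Omega> \<inter> ball z e = affine hull F \<inter> ball z e"
      using surface_flat_at_rel_interior[OF F z] by metis
    have "z \<in> \<Omega>" using z rel_interior_subset F by (auto simp: surface_eq)
    from surface_two_sided[OF F this e] show ?thesis using e(1) by blast
  qed
  have disj: "False" if "z \<in> A (inside \<Omega>)" "z \<in> A (outside \<Omega>)" for z
  proof -
    obtain d e where de: "d > 0" "e > 0" "below F z d \<subseteq> inside \<Omega>" "below F z e \<subseteq> outside \<Omega>"
      and z: "z \<in> rel_interior F"
      using \<open>z \<in> A (inside \<Omega>)\<close> \<open>z \<in> A (outside \<Omega>)\<close> by (auto simp: A_def)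
    have "below F z (min d e) \<subseteq> below F z d \<inter> below F z e" by auto
    then have "below F z (min d e) \<subseteq> inside \<Omega> \<inter> outside \<Omega>" using de by blast
    moreover have "below F z (min d e) \<noteq> {}"
      using de by (intro below_nonempty F plane z) auto
    ultimately show False by auto
  qed
  \<comment> \<open>The tangent point may be missing from \<open>rel_interior F\<close>, but it is a
    limit of such points, and a half-ball at a nearby \<open>z\<close> fits into the one at the
    tangent point.\<close>
  have "A (inside \<Omega>) \<noteq> {}"
  proof -
    obtain e where e: "e > 0" "below F (p + r *\<^sub>R nrm F) e \<subseteq> inside \<Omega>"
      using below_tangent_point_inside[OF F] .
    have "p + r *\<^sub>R nrm F \<in> closure (rel_interior F)"
      using nrm(2)[OF F] facet_closure[OF F] by simp
    then obtain z where z: "z \<in> rel_interior F" "dist z (p + r *\<^sub>R nrm F) < e / 2"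
      using e(1) unfolding closure_approachable by (meson half_gt_zero)
    then have "below F z (e / 2) \<subseteq> below F (p + r *\<^sub>R nrm F) e"
      by (intro below_mono) simp
    then have "z \<in> A (inside \<Omega>)"
      using z e by (auto simp: A_def intro!: exI[of _ "e / 2"])
    then show ?thesis by blast
  qed
  moreover have "rel_interior F \<subseteq> A (inside \<Omega>) \<union> A (outside \<Omega>)"
    using sides unfolding A_def by blast
  moreover have "A (inside \<Omega>) \<inter> A (outside \<Omega>) = {}"
    using disj by blast
  ultimately have "A (outside \<Omega>) = {}"
    using facet_connected[OF F] opn unfolding connected_openin by blast
  moreover obtain e where e: "e > 0" "below F y e \<subseteq> inside \<Omega> \<and> above F y e \<subseteq> outside \<Omega> \<or>
      below F y e \<subseteq> outside \<Omega> \<and> above F y e \<subseteq> inside \<Omega>"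
    using sides[OF y] by blast
  moreover have "y \<in> A (outside \<Omega>)" if "below F y e \<subseteq> outside \<Omega>"
    using y e(1) that unfolding A_def by blast
  ultimately have "below F y e \<subseteq> inside \<Omega> \<and> above F y e \<subseteq> outside \<Omega>"
    by blast
  then show thesis using that e(1) by blast
qed

section \<open>Rays from the center\<close>

definition exceptional :: "'a set" where
  "exceptional = insert p (\<Union>F\<in>\<F>. \<Union>t. dilation p t ` rel_frontier F)"

lemma negligible_exceptional: "negligible exceptional"
  unfolding exceptional_def negligible_insert
  by (intro negligible_Union finite_imageI finite_facets) (auto intro: negligible_rel_frontier_cone)

text \<open>The factor in \<open>exceptional\<close> runs over all reals, so the set is made of full
  lines through \<open>p\<close>. Avoiding it is therefore a property of the ray and not of the
  point chosen on it.\<close>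

lemma dilation_exceptional:
  assumes "t \<noteq> 0" "dilation p t z \<in> exceptional"
  shows "z \<in> exceptional"
proof -
  have z: "z = dilation p (1 / t) (dilation p t z)"
    using assms(1) by (simp add: dilation_dilation)
  consider "dilation p t z = p" | F s y where "F \<in> \<F>" "y \<in> rel_frontier F" "dilation p t z = dilation p s y"
    using assms(2) by (auto simp: exceptional_def)
  then show ?thesis
  proof cases
    case 1
    then show ?thesis using assms(1) by (simp add: exceptional_def dilation_def)
  next
    case 2
    then have "z = dilation p (1 / t * s) y"
      using z by (simp add: dilation_dilation)
    then show ?thesis using 2 unfolding exceptional_def by blast
  qed
qed

text \<open>Off \<open>exceptional\<close> a hit lies in the relative interior of a facet, where the
  two sides are known. Along the ray the height in the direction \<open>nrm F\<close> is
  \<open>s / t * r\<close>, which increases with \<open>s\<close> and passes \<open>r\<close> at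
  \<open>s = t\<close>.\<close>

lemma ray_crosses_outward:
  assumes z: "z \<notin> exceptional" and t: "t > 0" "dilation p t z \<in> \<Omega>"
  obtains F d where "F \<in> \<F>" "dilation p t z \<in> rel_interior F" "d > 0"
    "\<And>s. t - d < s \<Longrightarrow> s < t \<Longrightarrow> dilation p s z \<in> inside \<Omega>"
    "\<And>s. t < s \<Longrightarrow> s < t + d \<Longrightarrow> dilation p s z \<in> outside \<Omega>"
proof -
  define y where "y = dilation p t z"
  obtain F where F: "F \<in> \<F>" "y \<in> F" using t(2) by (auto simp: surface_eq y_def)
  have zy: "z = dilation p (1 / t) y"
    using t(1) by (simp add: y_def dilation_dilation)
  have "y \<notin> rel_frontier F"
    using z F(1) zy unfolding exceptional_def by blast
  then have y: "y \<in> rel_interior F"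
    using F(2) closure_closed[OF closed_facet[OF F(1)]] by (simp add: rel_frontier_def)
  obtain e where e: "e > 0" "below F y e \<subseteq> inside \<Omega>" "above F y e \<subseteq> outside \<Omega>"
    using facet_sides[OF F(1) y] .
  \<comment> \<open>The ray moves at speed \<open>norm (z - p)\<close>, so it stays in
    \<open>ball y e\<close> for parameters within \<open>d\<close> of \<open>t\<close>; the summand
    1 keeps the denominator positive.\<close>
  define d where "d = e / (norm (z - p) + 1)"
  have pos: "norm (z - p) + 1 > 0" by (simp add: add_nonneg_pos)
  then have d: "d > 0" using e(1) by (simp add: d_def)
  have near: "dilation p s z \<in> ball y e" if "\<bar>s - t\<bar> < d" for s
  proof -
    have "dilation p t z - dilation p s z = (t - s) *\<^sub>R (z - p)"
      by (simp add: dilation_def scaleR_diff_left)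
    then have "dist y (dilation p s z) = \<bar>s - t\<bar> * norm (z - p)"
      by (simp add: y_def dist_norm abs_minus_commute)
    also have "\<dots> \<le> \<bar>s - t\<bar> * (norm (z - p) + 1)"
      by (simp add: mult_left_mono)
    also have "\<dots> < d * (norm (z - p) + 1)"
      using that pos by (rule mult_strict_right_mono)
    also have "\<dots> = e" using pos by (simp add: d_def)
    finally show ?thesis by simp
  qed
  have inner: "nrm F \<bullet> (dilation p s z - p) = s / t * r" for s
  proof -
    have "t * (nrm F \<bullet> (z - p)) = r"
      using facet_plane[OF F] by (simp add: y_def dilation_def)
    then have "nrm F \<bullet> (z - p) = r / t" using t(1) by (simp add: field_simps)
    then show ?thesis by (simp add: dilation_def)
  qed
  show thesis
  proof (rule that[OF F(1) y[unfolded y_def] d])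
    fix s assume s: "t - d < s" "s < t"
    then have "s / t * r < 1 * r" using t(1) radius_pos by (intro mult_strict_right_mono) auto
    then show "dilation p s z \<in> inside \<Omega>"
      using near[of s] s e(2) inner[of s] by auto
  next
    fix s assume s: "t < s" "s < t + d"
    then have "1 * r < s / t * r" using t(1) radius_pos by (intro mult_strict_right_mono) auto
    then show "dilation p s z \<in> outside \<Omega>"
      using near[of s] s e(3) inner[of s] by auto
  qed
qed

lemma continuous_on_ray: "continuous_on S (\<lambda>s. dilation p s z)"
  unfolding dilation_def by (intro continuous_intros)

text \<open>The inside of a bounded set is bounded while the ray from \<open>z\<close> away from
  \<open>p\<close> is not, so the ray has to meet the surface.\<close>

lemma inside_in_cone:
  assumes z: "z \<in> inside \<Omega>" "z \<noteq> p"
  obtains t F where "t \<ge> 1" "F \<in> \<F>" "dilation p t z \<in> F"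
proof -
  define R where "R = (\<lambda>s. dilation p s z) ` {1..}"
  have "R \<inter> \<Omega> \<noteq> {}"
  proof
    assume "R \<inter> \<Omega> = {}"
    moreover have "connected R"
      unfolding R_def by (intro connected_continuous_image continuous_on_ray) simp
    moreover have "z \<in> R" unfolding R_def by (auto simp: image_iff intro!: bexI[of _ 1])
    moreover have "z \<notin> outside \<Omega>" using z(1) inside_Int_outside[of \<Omega>] by blast
    ultimately have "R \<subseteq> inside \<Omega>"
      using connected_subset_inside_or_outside by blast
    then have "bounded R"
      using bounded_inside[OF compact_imp_bounded[OF compact_surface]] bounded_subset by blast
    then obtain B where B: "\<And>w. w \<in> R \<Longrightarrow> dist p w \<le> B"
      by (metis bounded_any_center)
    have pos: "norm (z - p) > 0" using z(2) by simp
    \<comment> \<open>This parameter puts the point at distance at least \<open>B + 1\<close> from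
      \<open>p\<close>; the maximum with 1 keeps the point in \<open>R\<close>.\<close>
    define s where "s = max 1 ((B + 1) / norm (z - p))"
    have "dist p (dilation p s z) = s * norm (z - p)"
      by (simp add: dilation_def dist_norm s_def)
    also have "\<dots> \<ge> B + 1"
      using pos by (simp add: s_def max_def field_simps)
    finally show False using B[of "dilation p s z"] by (auto simp: R_def s_def)
  qed
  then show thesis using that by (auto simp: R_def surface_eq)
qed

text \<open>At its first hit a ray that starts outside would arrive from the outside, whereas every
  crossing arrives from the inside.\<close>

lemma outside_not_in_cone:
  assumes z: "z \<in> outside \<Omega>" "z \<notin> exceptional" and t: "t \<ge> 1"
  shows "dilation p t z \<notin> \<Omega>"
proof
  assume hit: "dilation p t z \<in> \<Omega>"
  define T where "T = {1..t} \<inter> (\<lambda>s. dilation p s z) -` \<Omega>"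
  have "compact T"
    unfolding T_def
    by (intro compact_continuous_image continuous_closed_vimage compact_Int_closed continuous_on_ray closed_vimage
        closed_surface compact_Icc)
  moreover have "t \<in> T" using t hit by (simp add: T_def)
  ultimately obtain u where u: "u \<in> T" "\<And>s. s \<in> T \<Longrightarrow> u \<le> s"
    using compact_attains_inf[of T] by blast
  have "z \<notin> \<Omega>" using z(1) outside_no_overlap[of \<Omega>] by blast
  then have "u \<noteq> 1" using u(1) by (auto simp: T_def)
  then have u1: "u > 1" using u(1) by (simp add: T_def)
  define C where "C = (\<lambda>s. dilation p s z) ` {1..<u}"
  have "C \<inter> \<Omega> = {}"
    using u by (force simp: C_def T_def)
  moreover have "connected C"
    unfolding C_def by (intro connected_continuous_image continuous_on_ray) simp
  moreover have "z \<in> C" using u1 by (auto simp: C_def image_iff intro!: bexI[of _ 1])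
  moreover have "z \<notin> inside \<Omega>" using z(1) inside_Int_outside[of \<Omega>] by blast
  ultimately have C: "C \<subseteq> outside \<Omega>"
    using connected_subset_inside_or_outside by blast
  obtain d where d: "d > 0" "\<And>s. u - d < s \<Longrightarrow> s < u \<Longrightarrow> dilation p s z \<in> inside \<Omega>"
  proof (rule ray_crosses_outward[OF z(2), of u])
    show "u > 0" "dilation p u z \<in> \<Omega>" using u1 u(1) by (auto simp: T_def)
  qed blast
  \<comment> \<open>A parameter shortly before the first hit \<open>u\<close> but not before the
    start 1, so that both descriptions apply to the same point.\<close>
  define s where "s = max 1 (u - d / 2)"
  have "u - d < s" "s < u" "1 \<le> s" using d(1) u1 by (auto simp: s_def)
  then have "dilation p s z \<in> inside \<Omega>" "dilation p s z \<in> C"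
    using d(2) by (auto simp: C_def)
  then show False using C inside_Int_outside[of \<Omega>] by blast
qed

lemma cone_preimage:
  assumes "z \<in> solid_cone p F" "z \<noteq> p"
  obtains t where "t \<ge> 1" "dilation p t z \<in> F"
proof -
  obtain u y where u: "0 \<le> u" "u \<le> 1" "y \<in> F" "z = dilation p u y"
    using assms(1) by (auto simp: solid_cone_def)
  have "u \<noteq> 0" using assms(2) u by (auto simp: dilation_def)
  then show thesis
    using u by (intro that[of "1 / u"]) (auto simp: dilation_dilation)
qed

text \<open>After a hit the ray is outside and cannot hit again, so both facets are met at the same
  point, which lies in the relative interior of some facet \<open>H\<close>. That interior meets no
  other facet, so \<open>F\<close> and \<open>G\<close> would both be \<open>H\<close>.\<close>

lemma cones_almost_disjoint:
  assumes F: "F \<in> \<F>" and G: "G \<in> \<F>" "F \<noteq> G"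
  shows "solid_cone p F \<inter> solid_cone p G \<subseteq> exceptional"
proof (rule subsetI, rule ccontr)
  fix z assume z: "z \<in> solid_cone p F \<inter> solid_cone p G" "z \<notin> exceptional"
  have zp: "z \<noteq> p" using z(2) by (auto simp: exceptional_def)
  obtain s t where st: "s \<ge> 1" "dilation p s z \<in> F" "t \<ge> 1" "dilation p t z \<in> G"
    using z(1) cone_preimage zp by (metis IntD1 IntD2)
  have hit: "dilation p s z \<in> \<Omega>" "dilation p t z \<in> \<Omega>"
    using st F G by (auto simp: surface_eq)
  have no_second_hit: False if ab: "1 \<le> a" "a < b" "dilation p a z \<in> \<Omega>" "dilation p b z \<in> \<Omega>" for a b
  proof -
    obtain d where d: "d > 0" "\<And>s. a < s \<Longrightarrow> s < a + d \<Longrightarrow> dilation p s z \<in> outside \<Omega>"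
    proof (rule ray_crosses_outward[OF z(2), of a])
      show "a > 0" "dilation p a z \<in> \<Omega>" using ab by auto
    qed blast
    \<comment> \<open>\<open>m\<close> lies beyond \<open>a\<close>, in the stretch of length
      \<open>d\<close> known to be outside, and not beyond \<open>b\<close>; seen from there the hit
      at \<open>b\<close> has a factor \<open>b / m\<close> of at least 1.\<close>
    define c where "c = min b (a + d / 2)"
    define m where "m = (a + c) / 2"
    have m: "a < m" "m < a + d" "m \<le> b" using d(1) ab by (auto simp: m_def c_def)
    have "dilation p m z \<notin> exceptional"
      using z(2) dilation_exceptional[of m z] m ab by auto
    then have "dilation p (b / m) (dilation p m z) \<notin> \<Omega>"
      using outside_not_in_cone[of "dilation p m z" "b / m"] d(2)[OF m(1,2)] m ab by auto
    then show False using ab m by (simp add: dilation_dilation)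
  qed
  have "s = t"
    using no_second_hit[of s t] no_second_hit[of t s] st hit by (meson linorder_neqE_linordered_idom)
  moreover obtain H where H: "H \<in> \<F>" "dilation p s z \<in> rel_interior H"
  proof (rule ray_crosses_outward[OF z(2), of s])
    show "s > 0" "dilation p s z \<in> \<Omega>" using st(1) hit(1) by auto
  qed blast
  ultimately have "dilation p s z \<in> rel_interior H \<inter> F" "dilation p s z \<in> rel_interior H \<inter> G"
    using st by auto
  then show False
    using rel_interior_facet_disjoint[OF H(1) F] rel_interior_facet_disjoint[OF H(1) G(1)] G(2) by blast
qed

lemma facet_in_plane: "F \<in> \<F> \<Longrightarrow> F \<subseteq> {y. nrm F \<bullet> (y - p) = r}"
  using facet_plane by blast

theorem measure_enclosed_region:
  "measure lebesgue (enclosed_region \<Omega>) = (\<Sum>F\<in>\<F>. measure lebesgue (solid_cone p F))"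
proof -
  have meas: "solid_cone p F \<in> lmeasurable" if "F \<in> \<F>" for F
    by (intro lmeasurable_compact compact_solid_cone compact_facet that)
  have "measure lebesgue (\<Union>(solid_cone p ` \<F>)) = (\<Sum>F\<in>\<F>. measure lebesgue (solid_cone p F))"
    by (intro measure_negligible_finite_Union_image finite_facets meas pairwiseI
        negligible_subset[OF negligible_exceptional] cones_almost_disjoint)
  moreover have "measure lebesgue (enclosed_region \<Omega>) = measure lebesgue (\<Union>(solid_cone p ` \<F>))"
  proof (rule measure_negligible_symdiff)
    show "\<Union>(solid_cone p ` \<F>) \<in> lmeasurable"
      using meas finite_facets by (intro fmeasurable.finite_Union) auto
    have "\<Union>(solid_cone p ` \<F>) - enclosed_region \<Omega> \<subseteq> exceptional"
    proof
      fix z assume z: "z \<in> \<Union>(solid_cone p ` \<F>) - enclosed_region \<Omega>"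
      then obtain F where F: "F \<in> \<F>" "z \<in> solid_cone p F" by auto
      have out: "z \<in> outside \<Omega>" using z by (auto simp: enclosed_region_def outside_inside)
      show "z \<in> exceptional"
      proof (rule ccontr)
        assume n: "z \<notin> exceptional"
        then have "z \<noteq> p" by (auto simp: exceptional_def)
        with F obtain t where t: "t \<ge> 1" "dilation p t z \<in> F" by (metis cone_preimage)
        then have "dilation p t z \<in> \<Omega>" using F(1) by (auto simp: surface_eq)
        then show False using outside_not_in_cone[OF out n t(1)] by simp
      qed
    qed
    moreover have "enclosed_region \<Omega> - \<Union>(solid_cone p ` \<F>) \<subseteq> exceptional"
    proof
      fix z assume z: "z \<in> enclosed_region \<Omega> - \<Union>(solid_cone p ` \<F>)"
      show "z \<in> exceptional"
      proof (rule ccontr)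
        assume "z \<notin> exceptional"
        then have zp: "z \<noteq> p" by (auto simp: exceptional_def)
        have "\<exists>t F. t \<ge> 1 \<and> F \<in> \<F> \<and> dilation p t z \<in> F"
        proof (cases "z \<in> \<Omega>")
          case True
          then show ?thesis by (intro exI[of _ 1]) (auto simp: surface_eq)
        next
          case False
          then have "z \<in> inside \<Omega>" using z by (auto simp: enclosed_region_def)
          then show ?thesis using inside_in_cone zp by metis
        qed
        then obtain t F where t: "t \<ge> 1" "F \<in> \<F>" "dilation p t z \<in> F" by blast
        then have "z = dilation p (1 / t) (dilation p t z)" by (simp add: dilation_dilation)
        moreover have "1 / t \<in> {0..1}" using t(1) by simp
        ultimately have "z \<in> solid_cone p F" unfolding solid_cone_def using t(3) by blast
        then show False using z t(2) by blast
      qed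
    qed
    ultimately show "negligible (\<Union>(solid_cone p ` \<F>) - enclosed_region \<Omega> \<union> (enclosed_region \<Omega> - \<Union>(solid_cone p ` \<F>)))"
      by (intro negligible_subset[OF negligible_exceptional]) blast
  qed
  ultimately show ?thesis by simp
qed

end

section \<open>Polygonal curves\<close>

fun polyline_length :: "'a::metric_space list \<Rightarrow> real" where
  "polyline_length (a # b # ws) = dist a b + polyline_length (b # ws)"
| "polyline_length _ = 0"

lemma polyline_length_eq_sum:
  "polyline_length ws = (\<Sum>i<length ws - 1. dist (ws ! i) (ws ! Suc i))"
proof (induction ws rule: polyline_length.induct)
  case (1 a b ws)
  then show ?case by (simp add: sum.lessThan_Suc_shift del: sum.lessThan_Suc)
qed auto

lemma pathstart_polygonal_path: "ws \<noteq> [] \<Longrightarrow> pathstart (polygonal_path ws) = hd ws"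
  by (induction ws rule: polygonal_path.induct) auto

lemma pathfinish_polygonal_path: "ws \<noteq> [] \<Longrightarrow> pathfinish (polygonal_path ws) = last ws"
  by (induction ws rule: polygonal_path.induct) auto

lemma dilation_linepath: "dilation p c \<circ> linepath a b = linepath (dilation p c a) (dilation p c b)"
  by (rule ext) (simp add: dilation_eq linepath_def algebra_simps)

lemma polygonal_path_dilation:
  "ws \<noteq> [] \<Longrightarrow> dilation p c \<circ> polygonal_path ws = polygonal_path (map (dilation p c) ws)"
  by (induction ws rule: polygonal_path.induct) (simp_all add: dilation_linepath path_compose_join)

lemma polyline_length_dilation:
  fixes ws :: "'a::real_normed_vector list"
  shows "polyline_length (map (dilation p c) ws) = \<bar>c\<bar> * polyline_length ws"
proof (induction ws rule: polyline_length.induct)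
  case (1 a b ws)
  have "dilation p c a - dilation p c b = c *\<^sub>R (a - b)" by (simp add: dilation_def algebra_simps)
  then have "dist (dilation p c a) (dilation p c b) = \<bar>c\<bar> * dist a b" by (simp add: dist_norm)
  then show ?case using 1 by (simp add: distrib_left)
qed auto

text \<open>A length function along the path: it dominates all chords, so that the chord sums in
  \<^const>\<open>curve_length\<close> telescope.\<close>

lemma polygonal_path_arclength:
  assumes "ws \<noteq> []"
  shows "\<exists>l. l 0 = 0 \<and> l 1 = polyline_length ws \<and>
    (\<forall>s t. 0 \<le> s \<and> s \<le> t \<and> t \<le> 1 \<longrightarrow> dist (polygonal_path ws s) (polygonal_path ws t) \<le> l t - l s)"
  using assms
proof (induction ws rule: polygonal_path.induct)
  case (2 a)
  show ?case by (intro exI[of _ "\<lambda>_. 0"]) (simp add: linepath_def flip: scaleR_left_distrib)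
next
  case (3 a b)
  have "dist (linepath a b s) (linepath a b t) = \<bar>s - t\<bar> * dist a b" for s t
  proof -
    have "linepath a b s - linepath a b t = (s - t) *\<^sub>R (b - a)"
      by (simp add: linepath_def algebra_simps)
    then show ?thesis by (simp add: dist_norm norm_minus_commute)
  qed
  then show ?case
    by (intro exI[of _ "\<lambda>t. t * dist a b"]) (auto simp: left_diff_distrib)
next
  case (4 a b c ws)
  define g where "g = polygonal_path (b # c # ws)"
  obtain l where l: "l 0 = 0" "l 1 = polyline_length (b # c # ws)"
    "\<And>s t. 0 \<le> s \<Longrightarrow> s \<le> t \<Longrightarrow> t \<le> 1 \<Longrightarrow> dist (g s) (g t) \<le> l t - l s"
    using "4.IH" by (auto simp: g_def)
  have g0: "g 0 = b"
    using pathstart_polygonal_path[of "b # c # ws"] by (simp add: g_def pathstart_def)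
  have lin: "dist (linepath a b s) (linepath a b t) = \<bar>s - t\<bar> * dist a b" for s t
  proof -
    have "linepath a b s - linepath a b t = (s - t) *\<^sub>R (b - a)"
      by (simp add: linepath_def algebra_simps)
    then show ?thesis by (simp add: dist_norm norm_minus_commute)
  qed
  \<comment> \<open>\<open>+++\<close> spends the parameters up to 1/2 on the first edge and the
    others on the rest, each at double speed; \<open>m\<close> concatenates the two length functions
    accordingly.\<close>
  define m where "m t = (if t \<le> 1 / 2 then 2 * t * dist a b else dist a b + l (2 * t - 1))" for t
  have "dist ((linepath a b +++ g) s) ((linepath a b +++ g) t) \<le> m t - m s"
    if st: "0 \<le> s" "s \<le> t" "t \<le> 1" for s t
  proof -
    consider "t \<le> 1 / 2" | "s \<le> 1 / 2" "t > 1 / 2" | "s > 1 / 2" by linarith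
    then show ?thesis
    proof cases
      case 1
      then show ?thesis
        using st by (simp add: joinpaths_def m_def lin algebra_simps)
    next
      case 2
      \<comment> \<open>A chord from the first edge to the rest of the path is compared with the
        detour through the common vertex \<open>b\<close>.\<close>
      have "dist (linepath a b (2 * s)) (g (2 * t - 1))
          \<le> dist (linepath a b (2 * s)) (linepath a b 1) + dist (g 0) (g (2 * t - 1))"
        by (rule order_trans[OF dist_triangle[of _ _ b]]) (simp add: g0 linepath_1')
      also have "\<dots> \<le> (1 - 2 * s) * dist a b + (l (2 * t - 1) - l 0)"
        using st 2 l(3)[of 0 "2 * t - 1"] by (simp only: lin) auto
      finally show ?thesis
        using 2 by (simp add: joinpaths_def m_def l(1) algebra_simps)
    next
      case 3
      then show ?thesis
        using st l(3)[of "2 * s - 1" "2 * t - 1"] by (simp add: joinpaths_def m_def)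
    qed
  qed
  then show ?case
    using l by (intro exI[of _ m]) (auto simp: g_def m_def)
qed simp

text \<open>These parameters attain the supremum in \<open>curve_length\<close>. Joining a new first
  edge squeezes the old ones into the second half of the unit interval; \<open>hd ts = 0\<close>
  records that they start at the vertex where the new edge attaches.\<close>

lemma polygonal_path_vertex_parameters:
  assumes "ws \<noteq> []"
  shows "\<exists>ts. ts \<noteq> [] \<and> sorted ts \<and> set ts \<subseteq> {0..1} \<and> hd ts = 0 \<and>
    polyline_length (map (polygonal_path ws) ts) = polyline_length ws"
  using assms
proof (induction ws rule: polygonal_path.induct)
  case (2 a)
  show ?case by (intro exI[of _ "[0]"]) simp
next
  case (3 a b)
  show ?case by (intro exI[of _ "[0, 1]"]) (simp add: linepath_0' linepath_1')
next
  case (4 a b c ws)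
  define g where "g = polygonal_path (b # c # ws)"
  obtain ts where ts: "ts \<noteq> []" "sorted ts" "set ts \<subseteq> {0..1}" "hd ts = 0"
    "polyline_length (map g ts) = polyline_length (b # c # ws)"
    using "4.IH" by (auto simp: g_def)
  have g0: "g 0 = b"
    using pathstart_polygonal_path[of "b # c # ws"] by (simp add: g_def pathstart_def)
  define us where "us = map (\<lambda>t. (t + 1) / 2) ts"
  have "map (linepath a b +++ g) us = map g ts"
    unfolding us_def using ts(3) g0
    by (auto simp: joinpaths_def field_simps linepath_1')
  moreover have "map g ts = b # map g (tl ts)"
    using ts(1,4) g0 by (cases ts) auto
  moreover have "(linepath a b +++ g) 0 = a"
    by (simp add: joinpaths_def linepath_0')
  ultimately have "polyline_length (map (linepath a b +++ g) (0 # us)) = polyline_length (a # b # c # ws)"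
    using ts(5) by simp
  moreover have "sorted us"
    using ts(2) unfolding us_def sorted_map by (rule sorted_wrt_mono_rel[rotated]) simp
  moreover have "set us \<subseteq> {0..1}"
    using ts(3) by (auto simp: us_def)
  ultimately show ?case
    by (intro exI[of _ "0 # us"]) (auto simp: g_def)
qed simp

lemma polyline_length_map_le:
  assumes l: "\<And>s t. 0 \<le> s \<Longrightarrow> s \<le> t \<Longrightarrow> t \<le> 1 \<Longrightarrow> dist (g s) (g t) \<le> l t - l s"
    and "ts \<noteq> []" "sorted ts" "set ts \<subseteq> {0..1::real}"
  shows "polyline_length (map g ts) \<le> l (last ts) - l (hd ts)"
  using assms(2-4)
proof (induction ts rule: polyline_length.induct)
  case (1 s t ts)
  then have "dist (g s) (g t) \<le> l t - l s" by (intro l) auto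
  then show ?case using 1 by simp
qed auto

text \<open>The length function bounds every chord sum by the total length and the vertex parameters
  attain that bound, so the supremum is a maximum.\<close>

lemma curve_length_polygonal_path:
  assumes "ws \<noteq> []"
  shows "curve_length (polygonal_path ws) = polyline_length ws"
proof -
  define g where "g = polygonal_path ws"
  obtain l where l: "l 0 = 0" "l 1 = polyline_length ws"
    "\<And>s t. 0 \<le> s \<Longrightarrow> s \<le> t \<Longrightarrow> t \<le> 1 \<Longrightarrow> dist (g s) (g t) \<le> l t - l s"
    using polygonal_path_arclength[OF assms] by (auto simp: g_def)
  obtain us where us: "us \<noteq> []" "sorted us" "set us \<subseteq> {0..1}"
    "polyline_length (map g us) = polyline_length ws"
    using polygonal_path_vertex_parameters[OF assms] by (auto simp: g_def)
  have sum_eq: "(\<Sum>i<length ts - 1. dist (g (ts ! i)) (g (ts ! Suc i))) = polyline_length (map g ts)" for ts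
    unfolding polyline_length_eq_sum by (rule sum.cong) auto
  have "polyline_length (map g ts) \<le> polyline_length ws"
    if ts: "ts \<noteq> []" "sorted ts" "set ts \<subseteq> {0..1}" for ts
  proof -
    have "hd ts \<in> {0..1}" "last ts \<in> {0..1}"
      using ts(1,3) hd_in_set last_in_set by blast+
    then have "0 \<le> l (hd ts) - l 0" "0 \<le> l 1 - l (last ts)"
      using order_trans[OF zero_le_dist l(3)[of 0 "hd ts"]] order_trans[OF zero_le_dist l(3)[of "last ts" 1]]
      by auto
    then show ?thesis using polyline_length_map_le[of g l, OF l(3) ts] l(1,2) by linarith
  qed
  then show ?thesis
    unfolding curve_length_def g_def[symmetric] sum_eq
    using us by (intro cSup_eq_maximum) (auto simp: image_iff intro!: exI[of _ us])
qed

lemma curve_length_dilation_polygon: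
  "curve_length (dilation p c \<circ> polygon_curve vs) = \<bar>c\<bar> * polyline_length (vs @ [hd vs])"
  unfolding polygon_curve_def
  by (simp only: polygonal_path_dilation curve_length_polygonal_path polyline_length_dilation
      append_is_Nil_conv list.distinct simp_thms map_is_Nil_conv)

section \<open>Edges of a simple polygon\<close>

definition separated_segments :: "'a::euclidean_space list \<Rightarrow> bool" where
  "separated_segments ws \<longleftrightarrow> (\<forall>i<length ws - 1. ws ! i \<noteq> ws ! Suc i \<and>
     (\<forall>j<i. open_segment (ws ! i) (ws ! Suc i) \<inter> open_segment (ws ! j) (ws ! Suc j) = {}))"

lemma path_image_polygonal_path:
  "2 \<le> length ws \<Longrightarrow> path_image (polygonal_path ws) =
    (\<Union>i<length ws - 1. closed_segment (ws ! i) (ws ! Suc i))"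
proof (induction ws rule: polygonal_path.induct)
  case (4 a b c ws)
  have "{..<length (a # b # c # ws) - 1} = insert 0 (Suc ` {..<length (b # c # ws) - 1})"
    by (auto simp: lessThan_Suc_eq_insert_0)
  then show ?case
    using 4 pathstart_polygonal_path[of "b # c # ws"] by (simp add: path_image_join image_image)
qed auto

text \<open>The last hypothesis tolerates both endpoints of the new edge, so the lemma serves arcs,
  where only \<open>b\<close> is shared with the rest, as well as the closed polygon, where
  \<open>a\<close> is shared too.\<close>

lemma separated_segments_Cons:
  assumes "a \<noteq> b" "separated_segments (b # ws)" "ws \<noteq> []"
    and "closed_segment a b \<inter> path_image (polygonal_path (b # ws)) \<subseteq> {a, b}"
  shows "separated_segments (a # b # ws)"
proof -
  have "open_segment (ws' ! i) (ws' ! Suc i) \<inter> open_segment a b = {}"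
    if "i < length ws" "ws' = b # ws" for i ws'
  proof -
    have "2 \<le> length (b # ws)" using assms(3) by (cases ws) auto
    then have "closed_segment (ws' ! i) (ws' ! Suc i) \<subseteq> path_image (polygonal_path (b # ws))"
      using that by (subst path_image_polygonal_path) auto
    then show ?thesis using assms(4) by (auto simp: open_segment_def)
  qed
  note first = this[OF _ refl]
  show ?thesis
    unfolding separated_segments_def
  proof (intro allI impI conjI)
    fix i assume i: "i < length (a # b # ws) - 1"
    show "(a # b # ws) ! i \<noteq> (a # b # ws) ! Suc i"
      using assms(1,2) i by (cases i) (auto simp: separated_segments_def)
    fix j assume j: "j < i"
    then obtain i' where i': "i = Suc i'" by (cases i) auto
    show "open_segment ((a # b # ws) ! i) ((a # b # ws) ! Suc i) \<inter>
        open_segment ((a # b # ws) ! j) ((a # b # ws) ! Suc j) = {}"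
    proof (cases j)
      case 0
      then show ?thesis using first[of i'] i i' by simp
    next
      case (Suc j')
      then show ?thesis using assms(2) i i' j by (auto simp: separated_segments_def)
    qed
  qed
qed

lemma separated_segments_arc:
  fixes ws :: "'a::euclidean_space list"
  shows "2 \<le> length ws \<Longrightarrow> arc (polygonal_path ws) \<Longrightarrow> separated_segments ws"
proof (induction ws rule: polygonal_path.induct)
  case (3 a b)
  then show ?case by (auto simp: separated_segments_def arc_linepath dest: arc_distinct_ends)
next
  case (4 a b c ws)
  have st: "pathfinish (linepath a b) = pathstart (polygonal_path (b # c # ws))"
    using pathstart_polygonal_path[of "b # c # ws"] by simp
  have "arc (linepath a b)" "arc (polygonal_path (b # c # ws))"
    "path_image (linepath a b) \<inter> path_image (polygonal_path (b # c # ws)) \<subseteq> {b}"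
    using 4(3) arc_join_eq[OF st] pathstart_polygonal_path[of "b # c # ws"] by auto
  then show ?case
    using 4(1) arc_distinct_ends[of "linepath a b"]
    by (intro separated_segments_Cons[of a b "c # ws"]) auto
qed auto

text \<open>Without its first edge a simple closed polygon is an arc, and this arc meets the removed
  edge only in its two endpoints.\<close>

lemma separated_segments_polygon:
  fixes vs :: "'a::euclidean_space list"
  assumes "simple_path (polygon_curve vs)" "3 \<le> length vs"
  shows "separated_segments (vs @ [hd vs])"
proof -
  obtain a b c ws where vs: "vs = a # b # c # ws"
    using assms(2) by (metis Suc_le_length_iff numeral_3_eq_3)
  define us where "us = c # ws @ [a]"
  have curve: "polygon_curve vs = linepath a b +++ polygonal_path (b # us)"
    by (simp add: polygon_curve_def vs us_def)
  have ends: "pathstart (polygonal_path (b # us)) = b" "pathfinish (polygonal_path (b # us)) = a"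
    using pathstart_polygonal_path[of "b # us"] pathfinish_polygonal_path[of "b # us"]
    by (simp_all add: us_def)
  have "arc (linepath a b)" "arc (polygonal_path (b # us))"
    "path_image (linepath a b) \<inter> path_image (polygonal_path (b # us)) \<subseteq> {a, b}"
    using assms(1) simple_path_join_loop_eq[of "polygonal_path (b # us)" "linepath a b"] ends
    unfolding curve by auto
  then have "separated_segments (a # b # us)"
    by (intro separated_segments_Cons separated_segments_arc) (auto dest: arc_distinct_ends simp: us_def)
  then show ?thesis by (simp add: vs us_def)
qed

text \<open>Appending the first vertex replaces the index modulo \<open>length vs\<close>; the two
  differ only at the last edge, where \<open>Suc i = length vs\<close>.\<close>

lemma polygon_edges_eq:
  assumes "vs \<noteq> []"
  shows "polygon_edges vs =
    (\<lambda>i. closed_segment ((vs @ [hd vs]) ! i) ((vs @ [hd vs]) ! Suc i)) ` {..<length vs}"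
proof -
  have "vs ! ((i + 1) mod length vs) = (vs @ [hd vs]) ! Suc i" if "i < length vs" for i
    using that assms by (cases "Suc i = length vs") (auto simp: nth_append hd_conv_nth)
  moreover have "vs ! i = (vs @ [hd vs]) ! i" if "i < length vs" for i
    using that by (simp add: nth_append)
  moreover have "polygon_edges vs = (\<lambda>i. closed_segment (vs ! i) (vs ! ((i + 1) mod length vs))) ` {..<length vs}"
    unfolding polygon_edges_def by blast
  ultimately show ?thesis by simp
qed

section \<open>Rescaling\<close>

text \<open>The inverse dilation pulls the component of the dilated point back into the bounded
  component of the original point. Using the inclusion with the factor \<open>1 / c\<close> as well
  gives equality.\<close>

lemma dilation_image_inside_subset:
  fixes S :: "'a::real_normed_vector set"
  assumes c: "c \<noteq> 0"
  shows "dilation p c ` inside S \<subseteq> inside (dilation p c ` S)"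
proof (rule image_subsetI)
  fix x assume x: "x \<in> inside S"
  define f where "f = dilation p c"
  define g where "g = dilation p (1 / c)"
  have fg: "f (g y) = y" "g (f y) = y" for y
    using c by (simp_all add: f_def g_def dilation_dilation)
  have cont: "continuous_on A f" "continuous_on A g" for A
    unfolding f_def g_def dilation_def by (intro continuous_intros)+
  define C where "C = connected_component_set (- S) x"
  define D where "D = connected_component_set (- f ` S) (f x)"
  have bC: "bounded C" and xS: "x \<notin> S"
    using x by (auto simp: inside_def C_def)
  have fx: "f x \<notin> f ` S"
    using xS fg(2) by (metis imageE)
  have "g ` D \<subseteq> C"
    unfolding C_def
  proof (rule connected_component_maximal)
    have "f x \<in> D"
      using fx by (simp add: D_def connected_component_refl_eq)
    then show "x \<in> g ` D"
      using fg(2)[of x] by force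
    show "connected (g ` D)"
      unfolding D_def by (intro connected_continuous_image cont connected_connected_component)
    show "g ` D \<subseteq> - S"
    proof (rule image_subsetI)
      fix y assume "y \<in> D"
      then have "y \<notin> f ` S" using connected_component_subset by (fastforce simp: D_def)
      then show "g y \<in> - S" using fg(1)[of y] by (metis ComplI imageI)
    qed
  qed
  then have "D \<subseteq> f ` C"
    using fg(1) by (metis image_eqI image_subset_iff subsetI)
  moreover have "bounded (f ` C)"
  proof -
    have "f ` C = (\<lambda>x. (p - c *\<^sub>R p) + c *\<^sub>R x) ` C"
      by (simp add: f_def dilation_eq add.commute)
    then show ?thesis
      using bounded_translation[OF bounded_scaling[OF bC], of "p - c *\<^sub>R p" c] by (simp add: image_image)
  qed
  ultimately have "bounded D" using bounded_subset by blast
  then show "dilation p c x \<in> inside (dilation p c ` S)"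
    using fx by (simp add: inside_def D_def f_def)
qed

lemma enclosed_region_dilation:
  fixes S :: "'a::real_normed_vector set"
  assumes c: "c \<noteq> 0"
  shows "enclosed_region (dilation p c ` S) = dilation p c ` enclosed_region S"
proof -
  have inv: "dilation p (1 / c) ` dilation p c ` A = A" "dilation p c ` dilation p (1 / c) ` A = A" for A
    using c by (simp_all add: image_image dilation_dilation)
  have "dilation p (1 / c) ` inside (dilation p c ` S) \<subseteq> inside S"
    using dilation_image_inside_subset[of "1 / c" p "dilation p c ` S"] c by (simp add: inv)
  then have "inside (dilation p c ` S) \<subseteq> dilation p c ` inside S"
    using image_mono[of _ _ "dilation p c"] inv(2) by metis
  then show ?thesis
    unfolding enclosed_region_def using dilation_image_inside_subset[OF c, of p S] by blast
qed

text \<open>The measure scales with the power \<open>DIM('a)\<close> of \<open>r / r0\<close>.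
  Differentiation brings out the factor \<open>DIM('a) / r0\<close>, which the factor
  \<open>r0 / DIM('a)\<close> from the cone formula cancels.\<close>

lemma has_derivative_enclosed_region_dilation:
  fixes S :: "'a::euclidean_space set"
  assumes r0: "r0 > 0" and r: "r > 0"
    and vol: "measure lebesgue (enclosed_region S) = r0 / DIM('a) * \<sigma>"
  shows "((\<lambda>r. measure lebesgue (enclosed_region (dilation p (r / r0) ` S)))
    has_real_derivative (r / r0) ^ (DIM('a) - 1) * \<sigma>) (at r)"
proof -
  obtain d where d: "DIM('a) = Suc d" using DIM_positive gr0_implies_Suc by blast
  have "((\<lambda>r. (r / r0) ^ Suc d) has_real_derivative (1 + of_nat d) * (1 / r0 * (r / r0) ^ d)) (at r)"
    by (intro DERIV_power_Suc DERIV_cdivide DERIV_ident)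
  from DERIV_cmult_right[OF this[folded d], of "r0 / DIM('a) * \<sigma>"]
  have "((\<lambda>r. (r / r0) ^ DIM('a) * (r0 / DIM('a) * \<sigma>))
      has_real_derivative (r / r0) ^ (DIM('a) - 1) * \<sigma>) (at r)"
  proof (rule DERIV_cong)
    define x where "x = (r / r0) ^ d"
    have "1 + real d \<noteq> 0" by linarith
    then have "(1 + real d) * (1 / r0 * x) * (r0 / (1 + real d) * \<sigma>) = x * \<sigma>"
      using r0 by simp
    then show "(1 + of_nat d) * (1 / r0 * (r / r0) ^ d) * (r0 / DIM('a) * \<sigma>) = (r / r0) ^ (DIM('a) - 1) * \<sigma>"
      by (simp add: d x_def)
  qed
  then show ?thesis
  \<comment> \<open>The scaling of the enclosed region is established for nonzero factors only, so
    the two functions are compared on the open half-line of positive radii.\<close>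
  proof (rule has_field_derivative_transform_within_open[of _ _ _ "{0<..}"])
    show "(x / r0) ^ DIM('a) * (r0 / DIM('a) * \<sigma>) =
        measure lebesgue (enclosed_region (dilation p (x / r0) ` S))" if "x \<in> {0<..}" for x
      using that r0 by (simp add: enclosed_region_dilation measure_dilation_image vol)
  qed (use r in auto)
qed

section \<open>Null cones over the boundaries of facets\<close>

lemma negligible_ray:
  fixes a :: "'a::euclidean_space"
  assumes "2 \<le> DIM('a)"
  shows "negligible (range (\<lambda>t. dilation p t a))"
  by (rule negligible_differentiable_image_lowdim)
     (use assms in \<open>auto simp: dilation_def differentiable_on_def\<close>)

text \<open>Where \<open>g\<close> is differentiable the cone is a differentiable image of a set of
  two parameters, hence null in dimension at least 3. The finitely many break points contribute one
  line each.\<close>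

lemma negligible_cone_valid_path:
  fixes g :: "real \<Rightarrow> 'a::euclidean_space"
  assumes dim: "3 \<le> DIM('a)" and g: "valid_path g"
  shows "negligible (\<Union>t. dilation p t ` path_image g)"
proof -
  obtain K where K: "finite K" "g C1_differentiable_on {0..1} - K"
    using g by (auto simp: valid_path_def piecewise_C1_differentiable_on_def)
  define f where "f = (\<lambda>(s, t). dilation p s (g t))"
  have "f differentiable_on UNIV \<times> ({0..1} - K)"
    unfolding differentiable_on_def
  proof
    fix x :: "real \<times> real" assume "x \<in> UNIV \<times> ({0..1} - K)"
    then have "g differentiable (at (snd x))"
      using K(2) by (auto simp: C1_differentiable_on_eq)
    then obtain D where D: "(g has_derivative D) (at (snd x))"
      by (auto simp: differentiable_def)
    have "((\<lambda>x. g (snd x)) has_derivative (\<lambda>h. D (snd h))) (at x)"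
      using has_derivative_compose[OF has_derivative_snd[OF has_derivative_ident] D] .
    then have "(f has_derivative (\<lambda>h. fst x *\<^sub>R D (snd h) + fst h *\<^sub>R (g (snd x) - p))) (at x)"
      unfolding f_def dilation_def case_prod_unfold
      by (auto intro!: derivative_eq_intros)
    then show "f differentiable at x within UNIV \<times> ({0..1} - K)"
      using differentiableI differentiable_at_withinI by blast
  qed
  then have 1: "negligible (f ` (UNIV \<times> ({0..1} - K)))"
    using dim by (intro negligible_differentiable_image_lowdim) auto
  have 2: "negligible (\<Union>k\<in>K. range (\<lambda>t. dilation p t (g k)))"
    using K(1) dim by (intro negligible_Union) (auto intro: negligible_ray)
  have "(\<Union>t. dilation p t ` path_image g) \<subseteq>
      f ` (UNIV \<times> ({0..1} - K)) \<union> (\<Union>k\<in>K. range (\<lambda>t. dilation p t (g k)))"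
    by (force simp: path_image_def f_def)
  then show ?thesis
    using negligible_subset[OF negligible_Un[OF 1 2]] by blast
qed

section \<open>The two derivative formulas\<close>

theorem polygon_area_derivative:
  fixes vs :: "(real^2) list"
  assumes ngon: "ngon n vs"
    and inscribed: "largest_inscribed_sphere (path_image (polygon_curve vs)) p r0"
    and tangent: "\<forall>E \<in> polygon_edges vs. sphere_tangent_to p r0 E"
    and r: "r > 0"
  shows "((\<lambda>r. measure lebesgue (enclosed_region (dilation p (r / r0) ` path_image (polygon_curve vs))))
    has_real_derivative curve_length (dilation p (r / r0) \<circ> polygon_curve vs)) (at r)"
proof -
  define ws where "ws = vs @ [hd vs]"
  define seg where "seg i = closed_segment (ws ! i) (ws ! Suc i)" for i
  have len: "3 \<le> length vs" and simple: "simple_path (polygon_curve vs)"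
    using ngon by (auto simp: ngon_def)
  have vs: "vs \<noteq> []" using len by auto
  have ws: "ws \<noteq> []" "length ws - 1 = length vs" by (simp_all add: ws_def)
  have curve: "polygon_curve vs = polygonal_path ws" by (simp add: polygon_curve_def ws_def)
  have edges: "polygon_edges vs = seg ` {..<length vs}"
    unfolding seg_def ws_def by (rule polygon_edges_eq[OF vs])
  have sep: "ws ! i \<noteq> ws ! Suc i"
    "j < i \<Longrightarrow> open_segment (ws ! i) (ws ! Suc i) \<inter> open_segment (ws ! j) (ws ! Suc j) = {}"
    if "i < length vs" for i j
    using separated_segments_polygon[OF simple len] that
    by (auto simp: separated_segments_def ws_def)
  have ri: "rel_interior (seg i) = open_segment (ws ! i) (ws ! Suc i)" if "i < length vs" for i
    using sep(1)[OF that] by (simp add: seg_def rel_interior_closed_segment)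
  have disj: "rel_interior (seg i) \<inter> rel_interior (seg j) = {}"
    if "i < length vs" "j < length vs" "i \<noteq> j" for i j
    using sep(2)[of i j] sep(2)[of j i] that ri by (metis Int_commute linorder_neqE_nat)
  \<comment> \<open>The cones are summed over the set of edges but the length over indices. Equal
    edges at different indices would have relative interiors both equal and disjoint, hence
    empty.\<close>
  have inj: "inj_on seg {..<length vs}"
  proof (rule inj_onI, rule ccontr)
    fix i j assume ij: "i \<in> {..<length vs}" "j \<in> {..<length vs}" "seg i = seg j" "i \<noteq> j"
    then have "rel_interior (seg i) = {}" using disj[of i j] by auto
    then show False using ri[of i] sep(1)[of i] ij(1) by auto
  qed
  have r0: "r0 > 0" using inscribed by (simp add: largest_inscribed_sphere_def)
  have loop: "pathfinish (polygon_curve vs) = pathstart (polygon_curve vs)"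
    unfolding curve using pathstart_polygonal_path[OF ws(1)] pathfinish_polygonal_path[OF ws(1)] vs
    by (simp add: ws_def)
  interpret tangential_surface "path_image (polygon_curve vs)" "polygon_edges vs" p r0
  proof
    have "path_image (polygon_curve vs) homeomorphic sphere (0::complex) 1"
      by (rule homeomorphic_simple_path_image_circle[OF simple loop]) simp
    also have "sphere (0::complex) 1 homeomorphic sphere (0::real^2) 1"
      by (rule homeomorphic_spheres_gen) auto
    finally show "path_image (polygon_curve vs) homeomorphic sphere (0::real^2) 1" .
    show "path_image (polygon_curve vs) = \<Union>(polygon_edges vs)"
      unfolding curve edges using len ws
      by (subst path_image_polygonal_path) (auto simp: seg_def)
    show "pairwise (\<lambda>F G. rel_interior F \<inter> rel_interior G = {}) (polygon_edges vs)"
      unfolding edges using disj by (fastforce simp: pairwise_def)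
    show "sphere p r0 \<subseteq> enclosed_region (path_image (polygon_curve vs))"
      using inscribed by (simp add: largest_inscribed_sphere_def)
    fix F assume "F \<in> polygon_edges vs"
    then obtain i where i: "i < length vs" "F = seg i" by (auto simp: edges)
    have F: "F = closed_segment (ws ! i) (ws ! Suc i)" "ws ! i \<noteq> ws ! Suc i"
      using i sep(1) by (auto simp: seg_def)
    show "aff_dim F = int (DIM(real^2) - 1)"
      using F by (simp add: segment_convex_hull aff_dim_convex_hull)
    show "connected (rel_interior F)" "F = closure (rel_interior F)"
      using F by (simp_all add: rel_interior_closed_segment convex_connected)
    have "rel_frontier F = {ws ! i, ws ! Suc i}"
      using F unfolding rel_frontier_def by (auto simp: rel_interior_closed_segment open_segment_def)
    then have "(\<Union>t. dilation p t ` rel_frontier F) =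
        range (\<lambda>t. dilation p t (ws ! i)) \<union> range (\<lambda>t. dilation p t (ws ! Suc i))"
      by auto
    then show "negligible (\<Union>t. dilation p t ` rel_frontier F)"
      by (simp add: negligible_ray)
  qed (use tangent r0 edges in auto)
  have cone: "measure lebesgue (solid_cone p (seg i)) = r0 / 2 * dist (ws ! i) (ws ! Suc i)"
    if "i < length vs" for i
  proof -
    have "seg i \<in> polygon_edges vs" using that edges by auto
    from measure_cone_segment[OF sep(1)[OF that] facet_in_plane[OF this, unfolded seg_def] nrm(1)[OF this, unfolded seg_def] r0]
    show ?thesis by (simp add: seg_def)
  qed
  have "measure lebesgue (enclosed_region (path_image (polygon_curve vs)))
      = (\<Sum>i<length vs. measure lebesgue (solid_cone p (seg i)))"
    unfolding measure_enclosed_region unfolding edges by (simp add: sum.reindex[OF inj])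
  also have "\<dots> = r0 / DIM(real^2) * polyline_length ws"
    unfolding polyline_length_eq_sum ws sum_distrib_left by (rule sum.cong) (auto simp: cone)
  finally have "((\<lambda>r. measure lebesgue (enclosed_region (dilation p (r / r0) ` path_image (polygon_curve vs))))
    has_real_derivative (r / r0) ^ (DIM(real^2) - 1) * polyline_length ws) (at r)"
    by (rule has_derivative_enclosed_region_dilation[OF r0 r])
  then show ?thesis
    using r r0 by (simp add: curve_length_dilation_polygon ws_def)
qed

theorem polyhedron_volume_derivative:
  fixes \<Omega> :: "(real^3) set"
  assumes sphere: "\<Omega> homeomorphic sphere (0::real^3) 1"
    and decomp: "facet_decomposition \<Omega> \<F>"
    and boundary: "\<forall>F \<in> \<F>. piecewise_smooth_boundary F"
    and inscribed: "largest_inscribed_sphere \<Omega> p r0"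
    and tangent: "\<forall>F \<in> \<F>. sphere_tangent_to p r0 F"
    and r: "r > 0"
  shows "((\<lambda>r. measure lebesgue (enclosed_region (dilation p (r / r0) ` \<Omega>)))
    has_real_derivative surface_area ((`) (dilation p (r / r0)) ` \<F>)) (at r)"
proof -
  have r0: "r0 > 0" using inscribed by (simp add: largest_inscribed_sphere_def)
  have facet: "planar_facet F" if "F \<in> \<F>" for F
    using decomp that by (auto simp: facet_decomposition_def)
  interpret tangential_surface \<Omega> \<F> p r0
  proof
    show "\<Omega> homeomorphic sphere (0::real^3) 1" by (rule sphere)
    show "finite \<F>" "\<Omega> = \<Union>\<F>" "pairwise (\<lambda>F G. rel_interior F \<inter> rel_interior G = {}) \<F>"
      using decomp by (auto simp: facet_decomposition_def)
    show "sphere p r0 \<subseteq> enclosed_region \<Omega>"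
      using inscribed by (simp add: largest_inscribed_sphere_def)
    fix F assume F: "F \<in> \<F>"
    show "aff_dim F = int (DIM(real^3) - 1)" "connected (rel_interior F)" "F = closure (rel_interior F)"
      using facet[OF F] by (simp_all add: planar_facet_def)
    obtain gs where gs: "finite gs" "\<And>g. g \<in> gs \<Longrightarrow> valid_path g" "rel_frontier F = (\<Union>g\<in>gs. path_image g)"
      using boundary F by (auto simp: piecewise_smooth_boundary_def)
    have "(\<Union>t. dilation p t ` rel_frontier F) = (\<Union>g\<in>gs. \<Union>t. dilation p t ` path_image g)"
      unfolding gs(3) by blast
    also have "negligible \<dots>"
      using gs by (intro negligible_Union) (auto intro: negligible_cone_valid_path)
    finally show "negligible (\<Union>t. dilation p t ` rel_frontier F)" .
  qed (use tangent r0 in auto)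
  have F: "compact F" "aff_dim F = 2" "F \<subseteq> {y. nrm F \<bullet> (y - p) = r0}" "norm (nrm F) = 1"
    if "F \<in> \<F>" for F
    using that compact_facet facet_dim facet_in_plane nrm(1) by auto
  have c: "r / r0 > 0" using r r0 by simp
  have "measure lebesgue (enclosed_region \<Omega>) = r0 / DIM(real^3) * surface_area \<F>"
    unfolding measure_enclosed_region surface_area_def sum_distrib_left
    by (rule sum.cong) (simp_all add: measure_cone_planar_area[OF F r0])
  then have "((\<lambda>r. measure lebesgue (enclosed_region (dilation p (r / r0) ` \<Omega>)))
    has_real_derivative (r / r0) ^ (DIM(real^3) - 1) * surface_area \<F>) (at r)"
    by (rule has_derivative_enclosed_region_dilation[OF r0 r])
  moreover have "surface_area ((`) (dilation p (r / r0)) ` \<F>) = (r / r0)\<^sup>2 * surface_area \<F>"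
  proof -
    \<comment> \<open>\<open>surface_area\<close> sums over a set of facets, so the dilation must
      not identify two of them.\<close>
    have "inj (dilation p (r / r0))"
      using c by (auto simp: inj_def dilation_def)
    then have "inj_on ((`) (dilation p (r / r0))) \<F>"
      by (simp add: inj_on_def inj_image_eq_iff)
    then show ?thesis
      unfolding surface_area_def sum_distrib_left
      by (subst sum.reindex) (auto intro!: sum.cong simp: planar_area_dilation[OF F r0 c])
  qed
  ultimately show ?thesis by simp
qed

theorem theorem1p4:
  shows
    "(\<forall>(n::nat) (vs::(real^2) list) (p::real^2) (r0::real).
        ngon n vs \<longrightarrow>
        largest_inscribed_sphere (path_image (polygon_curve vs)) p r0 \<longrightarrow>
        (\<forall>E \<in> polygon_edges vs. sphere_tangent_to p r0 E) \<longrightarrow>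
        (\<forall>r>0.
          ((\<lambda>r. measure lebesgue
                  (enclosed_region (dilation p (r / r0) ` path_image (polygon_curve vs))))
            has_real_derivative curve_length (dilation p (r / r0) \<circ> polygon_curve vs)) (at r)))
     \<and>
     (\<forall>(\<Omega>::(real^3) set) (\<F>::(real^3) set set) (p::real^3) (r0::real).
        \<Omega> homeomorphic sphere (0::real^3) 1 \<longrightarrow>
        facet_decomposition \<Omega> \<F> \<longrightarrow>
        (\<forall>F \<in> \<F>. piecewise_smooth_boundary F) \<longrightarrow>
        largest_inscribed_sphere \<Omega> p r0 \<longrightarrow>
        (\<forall>F \<in> \<F>. sphere_tangent_to p r0 F) \<longrightarrow>
        (\<forall>r>0.
          ((\<lambda>r. measure lebesgue (enclosed_region (dilation p (r / r0) ` \<Omega>)))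
            has_real_derivative surface_area ((`) (dilation p (r / r0)) ` \<F>)) (at r)))"
  using polygon_area_derivative polyhedron_volume_derivative by blast

end
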